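(* Let $P(\lambda)=\sum_{i=0}^k\lambda^iA_i$ be an $n\times n$ matrix polynomial of degree $k$ with $A_i\in\mathbb{C}^{n\times n}$, let $\lambda_0\in\mathbb{C}$, let $r<kn$ be a positive integer, and let $\Gamma=\{[\gamma_1\ \cdots\ \gamma_r]:\gamma_i>0,\ 1\leqslant i\leqslant r\}$. For $\gamma\in\Gamma$ put $f(\gamma):=\sigma_{(r+1)n-r}(T_\gamma(P,\lambda_0))$, $$F_1(\gamma):=\|M(\lambda_0;r)\|_2^2\max_{1\leqslant p\leqslant r}\left(1+\sum_{t=1}^p\prod_{i=t}^p\gamma_{r+1-i}^2\right),$$ $$F_2(\gamma):=\|M(\lambda_0;r)\|_2^2\max\left\{\max_{1\leqslant p\leqslant k}\left(1+\sum_{t=1}^p\prod_{i=t}^p\gamma_{r+1-i}^2\right),\ \max_{k+1\leqslant p\leqslant r}\left(1+\sum_{t=p-k+1}^p\prod_{i=t}^p\gamma_{r+1-i}^2\right)\right\}$$ (the latter being used when $r>k$). Then for $s=2$ or $F$, $$\delta_s(P,\lambda_0,r+1)\geqslant\begin{cases}\displaystyle\sup_{\gamma\in\Gamma}\frac{f(\gamma)}{\sqrt{F_1(\gamma)}}&\text{if }r\leqslant k,\\[2ex]\displaystyle\sup_{\gamma\in\Gamma}\frac{f(\gamma)}{\sqrt{F_2(\gamma)}}&\text{if }r>k.\end{cases}$$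
   Context: $\sigma_i(A)$ is the $i$-th singular value of $A$ in decreasing order; $\|\cdot\|_2$ and $\|\cdot\|_F$ are the spectral and Frobenius norms; $P^i$ is the $i$-th derivative of $P$. $T_\gamma(P,\lambda_0)$ is the $(r+1)n\times(r+1)n$ block lower triangular matrix whose $n\times n$ block in block position $(i,j)$, $1\leqslant i,j\leqslant r+1$, is $\left(\prod_{l=j}^{i-1}\gamma_l\right)\frac{P^{i-j}(\lambda_0)}{(i-j)!}$ if $i\geqslant j$ (an empty product being $1$) and $0$ if $i<j$. $M(\lambda_0;r)=H(\lambda_0)\otimes I_n$, where $H(\lambda_0)$ is the $(k+1)\times(\min\{r,k\}+1)$ matrix with $(i,j)$ entry $\left.\frac{1}{(j-1)!}\frac{d^{j-1}\lambda^{i-1}}{d\lambda^{j-1}}\right|_{\lambda=\lambda_0}$. For $\Delta P(\lambda)=\sum_{i=0}^k\lambda^i\Delta A_i$, put $|||\Delta P|||_F=\left(\sum_{i=0}^k\|\Delta A_i\|_F^2\right)^{1/2}$ and $|||\Delta P|||_2=\|[\Delta A_0\ \cdots\ \Delta A_k]\|_2$. For $s=2$ or $F$, $\delta_s(P,\lambda_0,r+1)$ is the infimum of $|||\Delta P|||_s$ over all $\Delta P(\lambda)=\sum_{i=0}^k\lambda^i\Delta A_i$, $\Delta A_i\in\mathbb{C}^{n\times n}$ (any of which may be zero), such that $P+\Delta P$ has an elementary divisor $(\lambda-\lambda_0)^j$ with $j\geqslant r+1$. Elementary divisors are defined via the Smith form: $P(\lambda)=E(\lambda)D(\lambda)F(\lambda)$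 with $E,F$ matrix polynomials with nonzero constant determinants and $D=\mathrm{diag}(d_1,\dots,d_t,0,\dots,0)$, $d_i$ monic, $d_{i-1}\mid d_i$; if $d_i(\lambda)=\prod_j(\lambda-\lambda_{ij})^{c_{ij}}$ with distinct $\lambda_{ij}$ and $c_{ij}\geqslant1$, the factors $(\lambda-\lambda_{ij})^{c_{ij}}$ are the elementary divisors. *)

theory Defs
  imports
    "HOL-Library.Extended_Real"
    "HOL-Library.FuncSet"
    "HOL-Analysis.L2_Norm"
    "HOL-Computational_Algebra.Fundamental_Theorem_Algebra"
    "Jordan_Normal_Form.Schur_Decomposition"
    "Jordan_Normal_Form.Determinant"
begin

text \<open>
  The singular values of \<open>A\<close> are the nonnegative square roots of the eigenvalues of \<open>A\<^sup>* A\<close>,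
  counted with algebraic multiplicity. These eigenvalues are real and nonnegative, so \<open>Re\<close> is
  only a type conversion. The index \<open>i\<close> of \<open>singular_value\<close> starts at 1.
\<close>

definition singular_values :: "complex mat \<Rightarrow> real list" where
  "singular_values A = rev (sorted_list_of_multiset
     (image_mset (\<lambda>z. sqrt (Re z)) (proots (char_poly (mat_adjoint A * A)))))"

definition singular_value :: "nat \<Rightarrow> complex mat \<Rightarrow> real" where
  "singular_value i A = singular_values A ! (i - 1)"

definition vec_norm2 :: "complex vec \<Rightarrow> real" where
  "vec_norm2 v = L2_set (\<lambda>i. cmod (v $ i)) {..<dim_vec v}"

definition spectral_norm :: "complex mat \<Rightarrow> real" where
  "spectral_norm A =
     (SUP x\<in>{x \<in> carrier_vec (dim_col A). vec_norm2 x = 1}. vec_norm2 (A *\<^sub>v x))"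

definition frobenius_norm :: "complex mat \<Rightarrow> real" where
  "frobenius_norm A = L2_set (\<lambda>(i, j). cmod (A $$ (i, j))) ({..<dim_row A} \<times> {..<dim_col A})"

definition mat_poly :: "nat \<Rightarrow> nat \<Rightarrow> (nat \<Rightarrow> complex mat) \<Rightarrow> complex poly mat" where
  "mat_poly n k A = mat n n (\<lambda>(a, b). \<Sum>i\<le>k. monom (A i $$ (a, b)) i)"

text \<open>
  \<open>smith_form n P ds\<close>: \<open>diag(d\<^sub>1, \<dots>, d\<^sub>t, 0, \<dots>, 0)\<close> is a Smith form of the \<open>n \<times> n\<close> matrix
  polynomial \<open>P\<close>, where \<open>ds = [d\<^sub>1, \<dots>, d\<^sub>t]\<close> lists the nonzero diagonal entries only.
\<close>

definition smith_form :: "nat \<Rightarrow> complex poly mat \<Rightarrow> complex poly list \<Rightarrow> bool" where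
  "smith_form n P ds \<longleftrightarrow>
     length ds \<le> n \<and>
     (\<forall>d\<in>set ds. monic d) \<and>
     (\<forall>i. Suc i < length ds \<longrightarrow> ds ! i dvd ds ! Suc i) \<and>
     (\<exists>E F. E \<in> carrier_mat n n \<and> F \<in> carrier_mat n n \<and>
        (\<exists>c. c \<noteq> 0 \<and> det E = [:c:]) \<and> (\<exists>c. c \<noteq> 0 \<and> det F = [:c:]) \<and>
        P = E * mat n n (\<lambda>(i, j). if i = j \<and> i < length ds then ds ! i else 0) * F)"

definition elementary_divisors :: "nat \<Rightarrow> complex poly mat \<Rightarrow> complex poly set" where
  "elementary_divisors n P =
     {[:-\<mu>, 1:] ^ c | \<mu> c. c \<ge> 1 \<and> (\<exists>ds. smith_form n P ds \<and> (\<exists>d\<in>set ds. order \<mu> d = c))}"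

datatype norm_kind = Spectral | Frobenius

definition block_row :: "nat \<Rightarrow> nat \<Rightarrow> (nat \<Rightarrow> complex mat) \<Rightarrow> complex mat" where
  "block_row n k D = mat n ((k + 1) * n) (\<lambda>(a, b). D (b div n) $$ (a, b mod n))"

fun coeff_norm :: "norm_kind \<Rightarrow> nat \<Rightarrow> nat \<Rightarrow> (nat \<Rightarrow> complex mat) \<Rightarrow> real" where
  "coeff_norm Spectral n k D = spectral_norm (block_row n k D)"
| "coeff_norm Frobenius n k D = sqrt (\<Sum>i\<le>k. (frobenius_norm (D i))\<^sup>2)"

definition ed_distance ::
  "norm_kind \<Rightarrow> nat \<Rightarrow> nat \<Rightarrow> (nat \<Rightarrow> complex mat) \<Rightarrow> complex \<Rightarrow> nat \<Rightarrow> ereal" where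
  "ed_distance s n k A z0 m =
     (INF D \<in> {D. (\<forall>i\<le>k. D i \<in> carrier_mat n n) \<and>
                  (\<exists>j\<ge>m. [:-z0, 1:] ^ j \<in> elementary_divisors n (mat_poly n k A + mat_poly n k D))}.
        ereal (coeff_norm s n k D))"

text \<open>
  Matrix entries are indexed from 0, so position \<open>(a, b)\<close> lies in block \<open>(a div n + 1, b div n + 1)\<close>
  of a matrix with \<open>n \<times> n\<close> blocks indexed from 1.
\<close>

definition T_mat :: "nat \<Rightarrow> nat \<Rightarrow> (nat \<Rightarrow> real) \<Rightarrow> complex poly mat \<Rightarrow> complex \<Rightarrow> complex mat" where
  "T_mat n r \<gamma> P z0 = mat ((r + 1) * n) ((r + 1) * n) (\<lambda>(a, b).
     let i = a div n + 1; j = b div n + 1 in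
     if j \<le> i
     then complex_of_real (\<Prod>l\<in>{j..<i}. \<gamma> l) *
          (poly ((pderiv ^^ (i - j)) (P $$ (a mod n, b mod n))) z0 / fact (i - j))
     else 0)"

definition kronecker :: "complex mat \<Rightarrow> complex mat \<Rightarrow> complex mat" where
  "kronecker A B = mat (dim_row A * dim_row B) (dim_col A * dim_col B) (\<lambda>(a, b).
     A $$ (a div dim_row B, b div dim_col B) * B $$ (a mod dim_row B, b mod dim_col B))"

definition H_mat :: "nat \<Rightarrow> nat \<Rightarrow> complex \<Rightarrow> complex mat" where
  "H_mat k r z0 = mat (k + 1) (min r k + 1)
     (\<lambda>(i, j). poly ((pderiv ^^ j) (monom 1 i)) z0 / fact j)"

definition M_mat :: "nat \<Rightarrow> nat \<Rightarrow> nat \<Rightarrow> complex \<Rightarrow> complex mat" where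
  "M_mat n k r z0 = kronecker (H_mat k r z0) (1\<^sub>m n)"

definition Gam :: "nat \<Rightarrow> (nat \<Rightarrow> real) set" where
  "Gam r = {1..r} \<rightarrow>\<^sub>E {0<..}"

definition f_fun :: "nat \<Rightarrow> nat \<Rightarrow> nat \<Rightarrow> (nat \<Rightarrow> complex mat) \<Rightarrow> complex \<Rightarrow> (nat \<Rightarrow> real) \<Rightarrow> real" where
  "f_fun n k r A z0 \<gamma> = singular_value ((r + 1) * n - r) (T_mat n r \<gamma> (mat_poly n k A) z0)"

definition F1 :: "nat \<Rightarrow> nat \<Rightarrow> nat \<Rightarrow> complex \<Rightarrow> (nat \<Rightarrow> real) \<Rightarrow> real" where
  "F1 n k r z0 \<gamma> = (spectral_norm (M_mat n k r z0))\<^sup>2 *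
     (MAX p\<in>{1..r}. 1 + (\<Sum>t=1..p. \<Prod>i=t..p. (\<gamma> (r + 1 - i))\<^sup>2))"

definition F2 :: "nat \<Rightarrow> nat \<Rightarrow> nat \<Rightarrow> complex \<Rightarrow> (nat \<Rightarrow> real) \<Rightarrow> real" where
  "F2 n k r z0 \<gamma> = (spectral_norm (M_mat n k r z0))\<^sup>2 *
     max (MAX p\<in>{1..k}. 1 + (\<Sum>t=1..p. \<Prod>i=t..p. (\<gamma> (r + 1 - i))\<^sup>2))
         (MAX p\<in>{k+1..r}. 1 + (\<Sum>t=p-k+1..p. \<Prod>i=t..p. (\<gamma> (r + 1 - i))\<^sup>2))"

end

theory Submission
  imports Defs
begin

text \<open>
  Let $Q = P + \Delta P$ have an elementary divisor $(\lambda - \lambda_0)^j$ with $j > r$, and fix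
  $\gamma$. The idea is that $T_\gamma(Q)$ has a kernel of dimension at least $r+1$, so on that
  kernel $T_\gamma(P) = -T_\gamma(\Delta P)$, and the $r+1$ smallest singular values of
  $T_\gamma(P)$ are bounded by the norm of $T_\gamma(\Delta P)$.

  For the kernel, read $T_\gamma(Q)$ as multiplication of polynomial vectors by $Q$ modulo
  $(\lambda - \lambda_0)^{r+1}$ in the Taylor basis at $\lambda_0$, block $i$ being rescaled by
  $w_i = \gamma_1 \cdots \gamma_{i-1}$. The Smith form $Q = E D F$ yields a polynomial vector $g$, a column of
  the adjugate of $F$, with $g(\lambda_0) \neq 0$ and $(\lambda - \lambda_0)^{r+1} \mid Q g$
  (\<open>smith_form_root_vector\<close>). Every product $q g$ with a polynomial $q$ of degree at most $r$
  then lies in the kernel, and $g(\lambda_0) \neq 0$ makes the map from $q$ to the truncated Taylor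
  expansion of $q g$ injective (\<open>T_mat_root_vector_mat\<close>, \<open>root_vector_mat_inj\<close>).

  For the singular values, one half of the Courant-Fischer principle is enough: if
  $\|A x\| \leq C \|x\|$ on an $(m+1)$-dimensional subspace, then the $(m+1)$-st smallest singular
  value of $A$ is at most $C$ (\<open>singular_value_le\<close>). It rests on the unitary diagonalization of Hermitian matrices
  (\<open>hermitian_diagonalization\<close>), with the eigenvalues in any prescribed order.

  For the norm of $T_\gamma(\Delta P)$, block row $i$ applied to a vector $x$ with blocks $x_j$ is
  $[\Delta A_0 \cdots \Delta A_k] \, M(\lambda_0; r)$ applied to the vector that stacks
  $(w_i / w_j) \, x_j$. Summing the squared norms over $i$ leaves, for each $j$, the column weight
  $\sum_i (w_i / w_j)^2$, where $i$ runs over the block rows that meet column $j$; derivatives of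
  order above $k$ vanish, which caps the range of $i$ when $r > k$ (\<open>T_mat_norm_le\<close>). Reversing
  the indices turns these column weights into the sums in $F_1$ and $F_2$.
\<close>

section \<open>Adjoints\<close>

lemma mat_adjoint_carrier[simp]: "A \<in> carrier_mat m n \<Longrightarrow> mat_adjoint A \<in> carrier_mat n m"
  unfolding mat_adjoint_def by auto

lemma mat_adjoint_dim[simp]: "dim_row (mat_adjoint A) = dim_col A" "dim_col (mat_adjoint A) = dim_row A"
  unfolding mat_adjoint_def by auto

lemma mat_adjoint_index[simp]:
  "i < dim_col A \<Longrightarrow> j < dim_row A \<Longrightarrow> mat_adjoint A $$ (i, j) = conjugate (A $$ (j, i))"
  unfolding mat_adjoint_def by (simp add: mat_of_rows_index)

lemma mat_adjoint_mult:
  fixes A B :: "complex mat"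
  assumes "A \<in> carrier_mat l m" "B \<in> carrier_mat m n"
  shows "mat_adjoint (A * B) = mat_adjoint B * mat_adjoint A"
  by (rule eq_matI) (use assms in \<open>auto simp: scalar_prod_def mult.commute\<close>)

lemma mat_adjoint_adjoint: "mat_adjoint (mat_adjoint (A :: complex mat)) = A"
  by (rule eq_matI) auto

lemma mult_mat_vec_cscalar_prod:
  fixes A :: "complex mat"
  assumes "A \<in> carrier_mat m n" "x \<in> carrier_vec n" "y \<in> carrier_vec m"
  shows "(A *\<^sub>v x) \<bullet>c y = x \<bullet>c (mat_adjoint A *\<^sub>v y)"
proof -
  have "(A *\<^sub>v x) \<bullet>c y = (\<Sum>i<m. \<Sum>j<n. A $$ (i, j) * x $ j * cnj (y $ i))"
    using assms by (simp add: scalar_prod_def sum_distrib_right atLeast0LessThan)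
  also have "\<dots> = (\<Sum>j<n. \<Sum>i<m. A $$ (i, j) * x $ j * cnj (y $ i))"
    by (rule sum.swap)
  also have "\<dots> = x \<bullet>c (mat_adjoint A *\<^sub>v y)"
    using assms by (simp add: scalar_prod_def sum_distrib_left atLeast0LessThan mult_ac)
  finally show ?thesis .
qed

section \<open>Vector, Frobenius and spectral norms\<close>

lemma vec_norm2_nonneg[simp]: "0 \<le> vec_norm2 v"
  by (simp add: vec_norm2_def)

lemma vec_norm2_sq: "(vec_norm2 v)\<^sup>2 = (\<Sum>i<dim_vec v. (cmod (v $ i))\<^sup>2)"
  by (simp add: vec_norm2_def L2_set_def sum_nonneg)

lemma vec_norm2_sq_cscalar_prod: "complex_of_real ((vec_norm2 v)\<^sup>2) = v \<bullet>c v"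
  by (simp add: vec_norm2_sq scalar_prod_def complex_norm_square atLeast0LessThan del: of_real_power)

lemma vec_norm2_smult: "vec_norm2 (c \<cdot>\<^sub>v v) = cmod c * vec_norm2 v"
  unfolding vec_norm2_def
  by (subst L2_set_right_distrib) (auto simp: norm_mult intro!: L2_set_cong)

lemma vec_norm2_eq_0: "vec_norm2 v = 0 \<longleftrightarrow> v = 0\<^sub>v (dim_vec v)"
  by (auto simp: vec_norm2_def L2_set_eq_0_iff vec_eq_iff)

lemma vec_norm2_uminus: "vec_norm2 (- v) = vec_norm2 v"
  by (auto simp: vec_norm2_def intro!: L2_set_cong)

lemma frobenius_norm_sq:
  "(frobenius_norm A)\<^sup>2 = (\<Sum>i<dim_row A. \<Sum>j<dim_col A. (cmod (A $$ (i, j)))\<^sup>2)"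
  by (simp add: frobenius_norm_def L2_set_def sum_nonneg sum.cartesian_product case_prod_unfold)

lemma frobenius_norm_nonneg[simp]: "0 \<le> frobenius_norm A"
  by (simp add: frobenius_norm_def)

lemma frobenius_norm_bound:
  assumes "x \<in> carrier_vec (dim_col A)"
  shows "vec_norm2 (A *\<^sub>v x) \<le> frobenius_norm A * vec_norm2 x"
proof -
  have "(cmod ((A *\<^sub>v x) $ i))\<^sup>2 \<le> (\<Sum>j<dim_col A. (cmod (A $$ (i, j)))\<^sup>2) * (vec_norm2 x)\<^sup>2"
    if i: "i < dim_row A" for i
  proof -
    have "cmod ((A *\<^sub>v x) $ i) \<le> (\<Sum>j<dim_col A. \<bar>cmod (A $$ (i, j))\<bar> * \<bar>cmod (x $ j)\<bar>)"
      using i assms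
      by (simp add: scalar_prod_def atLeast0LessThan norm_mult[symmetric] norm_sum)
    also have "\<dots> \<le> L2_set (\<lambda>j. cmod (A $$ (i, j))) {..<dim_col A} * vec_norm2 x"
      using L2_set_mult_ineq[of "\<lambda>j. cmod (A $$ (i, j))" "\<lambda>j. cmod (x $ j)" "{..<dim_col A}"] assms
      by (simp add: vec_norm2_def)
    finally have "(cmod ((A *\<^sub>v x) $ i))\<^sup>2 \<le> (L2_set (\<lambda>j. cmod (A $$ (i, j))) {..<dim_col A} * vec_norm2 x)\<^sup>2"
      by (intro power_mono) auto
    then show ?thesis by (simp add: power_mult_distrib L2_set_def sum_nonneg)
  qed
  then have "(vec_norm2 (A *\<^sub>v x))\<^sup>2 \<le> (\<Sum>i<dim_row A. (\<Sum>j<dim_col A. (cmod (A $$ (i, j)))\<^sup>2) * (vec_norm2 x)\<^sup>2)"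
    unfolding vec_norm2_sq[of "A *\<^sub>v x"] by (auto intro!: sum_mono)
  also have "\<dots> = (frobenius_norm A * vec_norm2 x)\<^sup>2"
    by (simp add: frobenius_norm_sq power_mult_distrib sum_distrib_right)
  finally show ?thesis by (rule power2_le_imp_le) simp
qed

text \<open>
  The supremum that defines the spectral norm bounds its members only because the set is bounded
  above; the Frobenius norm is such a bound.
\<close>

lemma spectral_norm_bound:
  assumes x: "x \<in> carrier_vec (dim_col A)"
  shows "vec_norm2 (A *\<^sub>v x) \<le> spectral_norm A * vec_norm2 x"
proof (cases "vec_norm2 x = 0")
  case True
  then show ?thesis using frobenius_norm_bound[OF x] by simp
next
  case False
  define u where "u = complex_of_real (inverse (vec_norm2 x)) \<cdot>\<^sub>v x"
  have u: "u \<in> carrier_vec (dim_col A)" "vec_norm2 u = 1"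
    using x False by (auto simp: u_def vec_norm2_smult norm_inverse)
  have "bdd_above ((\<lambda>x. vec_norm2 (A *\<^sub>v x)) ` {x \<in> carrier_vec (dim_col A). vec_norm2 x = 1})"
    using frobenius_norm_bound[of _ A] by (intro bdd_aboveI2[where M = "frobenius_norm A"]) fastforce
  then have "vec_norm2 (A *\<^sub>v u) \<le> spectral_norm A"
    unfolding spectral_norm_def using u by (intro cSUP_upper) auto
  moreover have "vec_norm2 (A *\<^sub>v u) = inverse (vec_norm2 x) * vec_norm2 (A *\<^sub>v x)"
    using mult_mat_vec[of A _ _ x] x unfolding u_def by (subst mult_mat_vec) (auto simp: vec_norm2_smult norm_inverse)
  moreover have "vec_norm2 x > 0" using False vec_norm2_nonneg[of x] by linarith
  ultimately show ?thesis by (simp add: field_simps)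
qed

lemma spectral_norm_nonneg:
  assumes "dim_col A > 0"
  shows "0 \<le> spectral_norm A"
proof -
  have "vec_norm2 (unit_vec (dim_col A) 0) > 0"
    using assms vec_norm2_eq_0[of "unit_vec (dim_col A) 0"] vec_norm2_nonneg[of "unit_vec (dim_col A) 0"]
    by (metis dim_vec index_unit_vec(3) less_eq_real_def unit_vec_nonzero)
  moreover have "0 \<le> spectral_norm A * vec_norm2 (unit_vec (dim_col A) 0)"
    using spectral_norm_bound[of "unit_vec (dim_col A) 0" A] vec_norm2_nonneg order_trans
    by (metis unit_vec_carrier)
  ultimately show ?thesis by (simp add: zero_le_mult_iff)
qed

section \<open>Diagonalization of Hermitian matrices\<close>

text \<open>
  Completing an eigenvector to a unitary matrix is the deflation step of the spectral theorem. The
  Gram-Schmidt procedure keeps the first vector and returns orthogonal but not normalized vectors;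
  normalizing them matters, since $W^* W = 1$ makes $W^* G W$ both Hermitian and similar to $G$.
\<close>

lemma exists_unitary_first_column:
  fixes v :: "complex vec"
  assumes v: "v \<in> carrier_vec n" and v0: "v \<noteq> 0\<^sub>v n"
  shows "\<exists>W c. W \<in> carrier_mat n n \<and> mat_adjoint W * W = 1\<^sub>m n \<and> col W 0 = c \<cdot>\<^sub>v v"
proof -
  interpret cof_vec_space n "TYPE(complex)" .
  define b where "b = basis_completion v"
  define ws where "ws = gram_schmidt n b"
  from basis_completion[OF v v0, folded b_def]
  have dist_b: "distinct b" and indep: "\<not> lin_dep (set b)" and b: "set b \<subseteq> carrier_vec n"
    and hdb: "hd b = v" and len_b: "length b = n"
    by auto
  have n: "n \<noteq> 0" using v v0 by (auto simp: vec_eq_iff)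
  from hdb len_b n obtain vs where bv: "b = v # vs" by (cases b) auto
  from gram_schmidt_result[OF b dist_b indep refl, folded ws_def]
  have ws: "set ws \<subseteq> carrier_vec n" "corthogonal ws" "length ws = n"
    by (auto simp: len_b)
  have hdws: "ws ! 0 = v"
    using gram_schmidt_hd[OF v, of vs, folded bv] ws(3) n unfolding ws_def
    by (metis hd_conv_nth length_0_conv)
  have wsc: "ws ! i \<in> carrier_vec n" if "i < n" for i
    using ws that by auto
  define c where "c i = complex_of_real (inverse (vec_norm2 (ws ! i)))" for i
  define W where "W = mat_of_cols n (map (\<lambda>i. c i \<cdot>\<^sub>v (ws ! i)) [0..<n])"
  have W: "W \<in> carrier_mat n n" by (auto simp: W_def)
  have colW: "col W i = c i \<cdot>\<^sub>v (ws ! i)" if "i < n" for i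
    using that wsc[OF that] by (auto simp: W_def)
  have "mat_adjoint W * W = 1\<^sub>m n"
  proof (rule eq_matI)
    fix i j assume ij: "i < dim_row (1\<^sub>m n :: complex mat)" "j < dim_col (1\<^sub>m n :: complex mat)"
    then have i: "i < n" and j: "j < n" by auto
    have "(mat_adjoint W * W) $$ (i, j) = col W j \<bullet>c col W i"
      using W i j by (simp add: scalar_prod_def mult.commute)
    also have "\<dots> = c j * c i * (ws ! j \<bullet>c ws ! i)"
      using wsc[OF i] wsc[OF j] by (simp add: colW i j c_def conjugate_smult_vec)
    also have "\<dots> = (if i = j then 1 else 0)"
    proof (cases "i = j")
      case False
      then show ?thesis using corthogonalD[OF ws(2), of j i] i j ws(3) by auto
    next
      case True
      have "ws ! i \<bullet>c ws ! i \<noteq> 0" using corthogonalD[OF ws(2), of i i] i ws(3) by auto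
      moreover have "ws ! i \<bullet>c ws ! i = complex_of_real (vec_norm2 (ws ! i)) ^ 2"
        by (simp add: vec_norm2_sq_cscalar_prod[symmetric])
      ultimately show ?thesis using True by (simp add: c_def power2_eq_square field_simps)
    qed
    finally show "(mat_adjoint W * W) $$ (i, j) = 1\<^sub>m n $$ (i, j)" using i j by auto
  qed (use W in auto)
  then show ?thesis using W colW[of 0] n hdws by auto
qed

lemma mat_adjoint_four_block:
  fixes A B C D :: "complex mat"
  assumes "A \<in> carrier_mat m1 n1" "B \<in> carrier_mat m1 n2" "C \<in> carrier_mat m2 n1" "D \<in> carrier_mat m2 n2"
  shows "mat_adjoint (four_block_mat A B C D)
    = four_block_mat (mat_adjoint A) (mat_adjoint C) (mat_adjoint B) (mat_adjoint D)"
  by (rule eq_matI) (use assms in auto)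

lemma mult_block_diag_mat:
  fixes A1 B1 :: "'a :: semiring_1 mat"
  assumes "A1 \<in> carrier_mat p p" "B1 \<in> carrier_mat p p" "A2 \<in> carrier_mat m m" "B2 \<in> carrier_mat m m"
  shows "four_block_mat A1 (0\<^sub>m p m) (0\<^sub>m m p) A2 * four_block_mat B1 (0\<^sub>m p m) (0\<^sub>m m p) B2
    = four_block_mat (A1 * B1) (0\<^sub>m p m) (0\<^sub>m m p) (A2 * B2)"
  using assms by (subst mult_four_block_mat[of _ p p _ m _ m _ _ p _ m]) auto

text \<open>
  The eigenvalues may be listed in any order: each induction step deflates by an eigenvector for the
  head of the list. The first column of $W^* G W$ is $e$ times the first unit vector, so hermiticity
  clears the first row as well and leaves a block diagonal matrix whose lower block is Hermitian
  with the remaining eigenvalues.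
\<close>

lemma hermitian_diagonalization:
  fixes G :: "complex mat"
  assumes "G \<in> carrier_mat n n" "mat_adjoint G = G"
    and "char_poly G = (\<Prod>e\<leftarrow>es. [:- e, 1:])"
  shows "\<exists>U. U \<in> carrier_mat n n \<and> mat_adjoint U * U = 1\<^sub>m n \<and>
    mat_adjoint U * G * U = mat_diag n ((!) es)"
  using assms
proof (induction es arbitrary: n G)
  case Nil
  then have "n = 0" using degree_monic_char_poly[of G n] by simp
  then show ?case by (intro exI[of _ "1\<^sub>m 0"]) (auto intro!: eq_matI simp: mat_diag_def)
next
  case (Cons e es)
  note G = Cons.prems(1) and herm = Cons.prems(2) and cp = Cons.prems(3)
  let ?m = "n - 1"
  have mon: "monic (\<Prod>e\<leftarrow> es. [:- e, 1:])" by (rule monic_prod_list) auto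
  have "degree (char_poly G) = Suc (degree (\<Prod>e\<leftarrow> es. [:- e, 1:]))"
    unfolding cp list.map prod_list.Cons by (subst degree_mult_eq) (use mon in auto)
  with degree_monic_char_poly[OF G] have n: "n \<noteq> 0" by auto
  have "eigenvalue G e" unfolding eigenvalue_root_char_poly[OF G] cp by simp
  then obtain v where v: "v \<in> carrier_vec n" "v \<noteq> 0\<^sub>v n" "G *\<^sub>v v = e \<cdot>\<^sub>v v"
    using G unfolding eigenvalue_def eigenvector_def by auto
  obtain W c where W: "W \<in> carrier_mat n n" and WW: "mat_adjoint W * W = 1\<^sub>m n"
    and colW: "col W 0 = c \<cdot>\<^sub>v v"
    using exists_unitary_first_column[OF v(1,2)] by auto
  define H where "H = mat_adjoint W * G * W"
  have H: "H \<in> carrier_mat n n" using W G by (simp add: H_def mult_carrier_mat[of _ n n])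
  have WW': "W * mat_adjoint W = 1\<^sub>m n"
    using mat_mult_left_right_inverse[OF _ W WW] W by simp
  have H_herm: "mat_adjoint H = H"
    using W G herm unfolding H_def
    by (simp add: mat_adjoint_mult[of _ n n _ n] mat_adjoint_adjoint assoc_mult_mat[of _ n n _ n _ n])
  have H_col: "H $$ (i, 0) = (if i = 0 then e else 0)" if i: "i < n" for i
  proof -
    have "col (G * W) 0 = G *\<^sub>v (c \<cdot>\<^sub>v v)"
      using col_mult2[OF G W, of 0] n colW by simp
    also have "\<dots> = c \<cdot>\<^sub>v (e \<cdot>\<^sub>v v)"
      using mult_mat_vec[OF G v(1)] v(3) by simp
    also have "\<dots> = e \<cdot>\<^sub>v col W 0"
      by (simp add: colW smult_smult_assoc mult.commute)
    finally have "col (G * W) 0 = e \<cdot>\<^sub>v col W 0" .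
    then have "col H 0 = mat_adjoint W *\<^sub>v (e \<cdot>\<^sub>v col W 0)"
      using G W n unfolding H_def
      by (simp add: assoc_mult_mat[of _ n n _ n _ n] col_mult2[of _ n n _ n])
    also have "\<dots> = e \<cdot>\<^sub>v (mat_adjoint W *\<^sub>v col W 0)"
      using W n by (intro mult_mat_vec) auto
    also have "mat_adjoint W *\<^sub>v col W 0 = col (mat_adjoint W * W) 0"
      using W n by (simp add: col_mult2[of _ n n _ n])
    finally have "col H 0 $ i = (e \<cdot>\<^sub>v col (1\<^sub>m n) 0) $ i" by (simp add: WW)
    then show ?thesis using H n i by (simp split: if_splits)
  qed
  have H_row: "H $$ (0, j) = (if j = 0 then e else 0)" if j: "0 < j" "j < n" for j
  proof -
    have "H $$ (0, j) = conjugate (H $$ (j, 0))"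
      using mat_adjoint_index[of 0 H j] H_herm H j n by auto
    then show ?thesis using H_col[of j] j by simp
  qed
  define K where "K = mat ?m ?m (\<lambda>(i, j). H $$ (Suc i, Suc j))"
  let ?E = "mat_diag 1 (\<lambda>_. e)" and ?O = "0\<^sub>m 1 ?m :: complex mat" and ?O' = "0\<^sub>m ?m 1 :: complex mat"
  have K: "K \<in> carrier_mat ?m ?m" by (simp add: K_def)
  have H_block: "H = four_block_mat ?E ?O ?O' K"
    by (rule eq_matI) (use H K n H_col H_row in \<open>auto simp: K_def mat_diag_def\<close>)
  have K_herm: "mat_adjoint K = K"
  proof (rule eq_matI)
    fix i j assume "i < dim_row K" "j < dim_col K"
    then show "mat_adjoint K $$ (i, j) = K $$ (i, j)"
      using mat_adjoint_index[of "Suc i" H "Suc j"] H_herm H by (simp add: K_def)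
  qed (use K in auto)
  have "similar_mat H G"
    unfolding similar_mat_def
    using similar_mat_witI[OF WW WW' H_def H G mat_adjoint_carrier[OF W] W] by blast
  then have "char_poly G = char_poly H"
    by (simp add: char_poly_similar)
  also have "\<dots> = char_poly ?E * char_poly K"
    unfolding H_block by (rule char_poly_four_block_zeros_col[OF mat_diag_dim _ K]) simp
  finally have "char_poly G = char_poly ?E * char_poly K" .
  moreover have "char_poly ?E = [:- e, 1:]"
    by (simp add: mat_diag_def char_poly_defs det_def sign_def)
  ultimately have "char_poly K = (\<Prod>e\<leftarrow>es. [:- e, 1:])"
    using cp mult_cancel_left[of "[:- e, 1:]"] by (simp del: mult_pCons_left)
  from Cons.IH[OF K K_herm this] obtain V where V: "V \<in> carrier_mat ?m ?m"
    and VV: "mat_adjoint V * V = 1\<^sub>m ?m" and VKV: "mat_adjoint V * K * V = mat_diag ?m ((!) es)"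
    by auto
  define B where "B = four_block_mat (1\<^sub>m 1) ?O ?O' V"
  have B: "B \<in> carrier_mat n n" using V n by (auto simp: B_def)
  have B_adj: "mat_adjoint B = four_block_mat (1\<^sub>m 1) ?O ?O' (mat_adjoint V)"
    unfolding B_def using V
    by (subst mat_adjoint_four_block[of _ 1 1 _ ?m _ ?m]) (auto intro!: cong_four_block_mat eq_matI)
  have V_adj: "mat_adjoint V \<in> carrier_mat ?m ?m" using V by simp
  have E: "?E \<in> carrier_mat 1 1" by simp
  have "mat_adjoint B * B = four_block_mat (1\<^sub>m 1) ?O ?O' (1\<^sub>m ?m)"
    unfolding B_adj unfolding B_def by (simp only: mult_block_diag_mat[OF _ _ V_adj V] one_carrier_mat VV) simp
  then have BB: "mat_adjoint B * B = 1\<^sub>m n" using n by simp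
  have "mat_adjoint B * H = four_block_mat ?E ?O ?O' (mat_adjoint V * K)"
    unfolding B_adj H_block by (simp only: mult_block_diag_mat[OF one_carrier_mat E V_adj K] left_mult_one_mat[OF E])
  then have "mat_adjoint B * H * B = four_block_mat ?E ?O ?O' (mat_adjoint V * K * V)"
    using mult_block_diag_mat[OF E one_carrier_mat mult_carrier_mat[OF V_adj K] V] right_mult_one_mat[OF E]
    by (simp add: B_def)
  also have "\<dots> = mat_diag n ((!) (e # es))"
    unfolding VKV using n by (auto intro!: eq_matI simp: mat_diag_def)
  finally have BHB: "mat_adjoint B * H * B = mat_diag n ((!) (e # es))" .
  show ?case
  proof (intro exI[of _ "W * B"] conjI)
    show "W * B \<in> carrier_mat n n" using W B by simp
    have "mat_adjoint (W * B) * (W * B) = mat_adjoint B * ((mat_adjoint W * W) * B)"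
      using W B by (simp add: mat_adjoint_mult[of _ n n _ n] assoc_mult_mat[of _ n n _ n _ n])
    then show "mat_adjoint (W * B) * (W * B) = 1\<^sub>m n" using WW BB B by simp
    have "mat_adjoint (W * B) * G * (W * B) = mat_adjoint B * H * B"
      using W B G unfolding H_def
      by (simp add: mat_adjoint_mult[of _ n n _ n] assoc_mult_mat[of _ n n _ n _ n] mult_carrier_mat[of _ n n])
    then show "mat_adjoint (W * B) * G * (W * B) = mat_diag n ((!) (e # es))" using BHB by simp
  qed
qed

section \<open>An upper bound for singular values\<close>

lemma exists_kernel_vector_underdetermined:
  fixes Y :: "'a :: field mat"
  assumes "Y \<in> carrier_mat m (Suc m)"
  shows "\<exists>y. y \<in> carrier_vec (Suc m) \<and> y \<noteq> 0\<^sub>v (Suc m) \<and> Y *\<^sub>v y = 0\<^sub>v m"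
proof -
  \<comment> \<open>Padding with a zero row makes the matrix square and singular.\<close>
  define Z where "Z = mat (Suc m) (Suc m) (\<lambda>(i, j). if i < m then Y $$ (i, j) else 0)"
  have Z: "Z \<in> carrier_mat (Suc m) (Suc m)" by (simp add: Z_def)
  have "row Z m = 0\<^sub>v (Suc m)" by (rule eq_vecI) (auto simp: Z_def)
  then have "det Z = 0" using laplace_expansion_row[OF Z, of m] by (auto simp: Z_def)
  then obtain y where y: "y \<in> carrier_vec (Suc m)" "y \<noteq> 0\<^sub>v (Suc m)" "Z *\<^sub>v y = 0\<^sub>v (Suc m)"
    using det_0_iff_vec_prod_zero_field[OF Z] by auto
  have "Y *\<^sub>v y = 0\<^sub>v m"
  proof (rule eq_vecI)
    fix i assume "i < dim_vec (0\<^sub>v m)"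
    moreover from this have "row Z i = row Y i"
      using assms by (intro eq_vecI) (auto simp: Z_def)
    ultimately show "(Y *\<^sub>v y) $ i = 0\<^sub>v m $ i"
      using arg_cong[OF y(3), of "\<lambda>v. v $ i"] assms Z by simp
  qed (use assms in auto)
  then show ?thesis using y by blast
qed

text \<open>
  The columns of $X$ span an $(m+1)$-dimensional subspace, so some nonzero $v$ in it is orthogonal
  to the $m$ eigenvectors of $A^* A$ with the smallest eigenvalues. On the span of the other
  eigenvectors $\|A v\|$ is at least the singular value in question times $\|v\|$.
\<close>

lemma singular_value_le:
  assumes A: "A \<in> carrier_mat N N" and m: "m < N"
    and X: "X \<in> carrier_mat N (Suc m)"
    and inj: "\<And>y. y \<in> carrier_vec (Suc m) \<Longrightarrow> X *\<^sub>v y = 0\<^sub>v N \<Longrightarrow> y = 0\<^sub>v (Suc m)"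
    and bound: "\<And>y. y \<in> carrier_vec (Suc m) \<Longrightarrow> vec_norm2 (A *\<^sub>v (X *\<^sub>v y)) \<le> C * vec_norm2 (X *\<^sub>v y)"
    and C: "0 \<le> C"
  shows "singular_value (N - m) A \<le> C"
proof -
  define G where "G = mat_adjoint A * A"
  define f where "f z = sqrt (Re z)" for z
  have G: "G \<in> carrier_mat N N" using A by (simp add: G_def mult_carrier_mat[of _ N N])
  have herm: "mat_adjoint G = G"
    using A by (simp add: G_def mat_adjoint_mult[of _ N N _ N] mat_adjoint_adjoint)
  obtain as where as: "char_poly G = (\<Prod>a\<leftarrow>as. [:- a, 1:])" "length as = N"
    using char_poly_factorized[OF G] by auto
  \<comment> \<open>The eigenvalues in the order in which \<open>singular_values\<close> lists their square roots.\<close>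
  define es where "es = rev (sort_key f as)"
  have mset_es: "mset es = mset as" by (simp add: es_def)
  have len: "length es = N" using as(2) by (simp add: es_def)
  have cp: "char_poly G = (\<Prod>e\<leftarrow>es. [:- e, 1:])"
    unfolding as(1) by (simp add: mset_es flip: prod_mset_prod_list)
  have "proots (char_poly G) = mset es"
    unfolding cp
  proof (induction es)
    case (Cons e es)
    have "(\<Prod>e\<leftarrow>es. [:- e, 1:]) \<noteq> 0" by (auto simp: prod_list_zero_iff)
    then show ?case using Cons.IH by (simp add: proots_mult del: mult_pCons_left)
  qed simp
  moreover have "sort (map f es) = map f (sort_key f as)"
    by (rule properties_for_sort) (simp_all add: es_def)
  ultimately have svs: "singular_values A = map f es"
    unfolding singular_values_def G_def[symmetric]
    by (simp add: f_def[abs_def, symmetric] flip: mset_map) (simp add: es_def rev_map)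
  have dec: "f (es ! j) \<le> f (es ! i)" if "i \<le> j" "j < N" for i j
  proof -
    have "sorted (rev (map f es))" by (simp add: es_def rev_map)
    then show ?thesis using that len sorted_rev_nth_mono[of "map f es" i j] by simp
  qed
  obtain U where U: "U \<in> carrier_mat N N" and UU: "mat_adjoint U * U = 1\<^sub>m N"
    and UGU: "mat_adjoint U * G * U = mat_diag N ((!) es)"
    using hermitian_diagonalization[OF G herm cp] by auto
  have UU': "U * mat_adjoint U = 1\<^sub>m N"
    using mat_mult_left_right_inverse[OF _ U UU] U by simp
  define Y where "Y = mat_adjoint U * X"
  have Y: "Y \<in> carrier_mat N (Suc m)" using U X by (simp add: Y_def mult_carrier_mat[of _ N N])
  \<comment> \<open>The last \<open>m\<close> coordinates of \<open>U\<^sup>* X y\<close> are the ones along the small eigenvalues.\<close>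
  obtain y where y: "y \<in> carrier_vec (Suc m)" "y \<noteq> 0\<^sub>v (Suc m)"
    and ky: "mat m (Suc m) (\<lambda>(i, j). Y $$ (N - m + i, j)) *\<^sub>v y = 0\<^sub>v m"
    using exists_kernel_vector_underdetermined[of "mat m (Suc m) (\<lambda>(i, j). Y $$ (N - m + i, j))" m] by auto
  define a where "a = Y *\<^sub>v y"
  define v where "v = X *\<^sub>v y"
  have a: "a \<in> carrier_vec N" and v: "v \<in> carrier_vec N" using X Y y(1) by (simp_all add: a_def v_def)
  have a0: "a $ i = 0" if i: "N - m \<le> i" "i < N" for i
  proof -
    have "row Y i = row (mat m (Suc m) (\<lambda>(i, j). Y $$ (N - m + i, j))) (i - (N - m))"
      using i m Y by (intro eq_vecI) auto
    then show ?thesis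
      using arg_cong[OF ky, of "\<lambda>v. v $ (i - (N - m))"] i m Y by (simp add: a_def)
  qed
  have v_eq: "v = U *\<^sub>v a"
  proof -
    have "U *\<^sub>v a = (U * mat_adjoint U) *\<^sub>v v"
      using U X Y y by (simp add: a_def v_def Y_def assoc_mult_mat_vec[of _ N N _ "Suc m"] assoc_mult_mat_vec[of _ N N _ N])
    then show ?thesis using UU' v by simp
  qed
  have av: "(vec_norm2 v)\<^sup>2 = (\<Sum>i<N. (cmod (a $ i))\<^sup>2)"
  proof -
    have "v \<bullet>c v = a \<bullet>c ((mat_adjoint U * U) *\<^sub>v a)"
      using U a v unfolding v_eq by (simp add: mult_mat_vec_cscalar_prod[of _ N N] assoc_mult_mat_vec[of _ N N _ N])
    then have "complex_of_real ((vec_norm2 v)\<^sup>2) = complex_of_real ((vec_norm2 a)\<^sup>2)"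
      using a by (simp only: UU vec_norm2_sq_cscalar_prod) simp
    then show ?thesis using a by (simp only: of_real_eq_iff vec_norm2_sq) auto
  qed
  have "(A *\<^sub>v v) \<bullet>c (A *\<^sub>v v) = v \<bullet>c (G *\<^sub>v v)"
    using A v by (simp add: mult_mat_vec_cscalar_prod[of _ N N] G_def assoc_mult_mat_vec[of _ N N _ N])
  also have "\<dots> = a \<bullet>c ((mat_adjoint U * G * U) *\<^sub>v a)"
    using U a v G unfolding v_eq
    by (simp add: mult_mat_vec_cscalar_prod[of _ N N] assoc_mult_mat_vec[of _ N N _ N]
        mult_carrier_mat[of _ N N])
  also have "\<dots> = (\<Sum>i<N. cnj (es ! i) * complex_of_real ((cmod (a $ i))\<^sup>2))"
  proof -
    have "(mat_diag N ((!) es) *\<^sub>v a) $ i = es ! i * a $ i" if "i < N" for i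
    proof -
      have "(mat_diag N ((!) es) *\<^sub>v a) $ i = (\<Sum>j<N. (if i = j then es ! j else 0) * a $ j)"
        using that a by (simp add: mat_diag_def scalar_prod_def atLeast0LessThan)
      also have "\<dots> = (\<Sum>j<N. if i = j then es ! j * a $ j else 0)"
        by (intro sum.cong) auto
      finally have "(mat_diag N ((!) es) *\<^sub>v a) $ i = (\<Sum>j<N. if i = j then es ! j * a $ j else 0)" .
      then show ?thesis using that by simp
    qed
    moreover have "dim_vec (mat_diag N ((!) es) *\<^sub>v a) = N" by (simp add: mat_diag_def)
    ultimately show ?thesis
      using a unfolding UGU by (auto simp del: index_mult_mat_vec simp: scalar_prod_def atLeast0LessThan complex_norm_square mult_ac simp del: of_real_power intro!: sum.cong)
  qed
  finally have "complex_of_real ((vec_norm2 (A *\<^sub>v v))\<^sup>2)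
      = (\<Sum>i<N. cnj (es ! i) * complex_of_real ((cmod (a $ i))\<^sup>2))"
    by (simp only: vec_norm2_sq_cscalar_prod)
  then have "(vec_norm2 (A *\<^sub>v v))\<^sup>2 = Re (\<Sum>i<N. cnj (es ! i) * complex_of_real ((cmod (a $ i))\<^sup>2))"
    by (metis Re_complex_of_real)
  then have Av: "(vec_norm2 (A *\<^sub>v v))\<^sup>2 = (\<Sum>i<N. Re (es ! i) * (cmod (a $ i))\<^sup>2)"
    by simp
  define \<sigma> where "\<sigma> = Re (es ! (N - m - 1))"
  have "\<sigma> * (cmod (a $ i))\<^sup>2 \<le> Re (es ! i) * (cmod (a $ i))\<^sup>2" if i: "i < N" for i
  proof (cases "i < N - m")
    case True
    then have "\<sigma> \<le> Re (es ! i)" using dec[of i "N - m - 1"] m by (simp add: f_def \<sigma>_def)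
    then show ?thesis by (simp add: mult_right_mono)
  next
    case False
    then show ?thesis using a0[of i] i by simp
  qed
  then have "\<sigma> * (vec_norm2 v)\<^sup>2 \<le> (vec_norm2 (A *\<^sub>v v))\<^sup>2"
    unfolding Av av sum_distrib_left by (intro sum_mono) auto
  also have "\<dots> \<le> (C * vec_norm2 v)\<^sup>2"
    using bound[OF y(1)] by (intro power_mono) (auto simp: v_def)
  finally have "\<sigma> * (vec_norm2 v)\<^sup>2 \<le> C\<^sup>2 * (vec_norm2 v)\<^sup>2" by (simp add: power_mult_distrib)
  moreover have "vec_norm2 v \<noteq> 0" using inj[OF y(1)] y(2) v by (metis carrier_vecD v_def vec_norm2_eq_0)
  ultimately have "\<sigma> \<le> C\<^sup>2" by simp
  then have "sqrt \<sigma> \<le> C" using C by (metis real_sqrt_le_iff real_sqrt_abs abs_of_nonneg)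
  then show ?thesis using m len by (simp add: singular_value_def svs f_def \<sigma>_def)
qed

section \<open>Taylor coefficients of polynomials\<close>

text \<open>
  Defining the coefficients through the shifted polynomial makes Taylor expansion a ring
  homomorphism, so that products become convolutions.
\<close>

definition taylor_coeff :: "'a :: field_char_0 poly \<Rightarrow> 'a \<Rightarrow> nat \<Rightarrow> 'a" where
  "taylor_coeff p z m = coeff (pcompose p [:z, 1:]) m"

lemma taylor_coeff_higher_pderiv: "poly ((pderiv ^^ m) p) z / fact m = taylor_coeff p z m"
proof -
  have "(pderiv ^^ m) (pcompose p [:z, 1:]) = pcompose ((pderiv ^^ m) p) [:z, 1:]"
    by (induction m) (simp_all add: pderiv_pcompose pderiv_pCons)
  then have "poly ((pderiv ^^ m) p) z = coeff ((pderiv ^^ m) (pcompose p [:z, 1:])) 0"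
    by (simp add: poly_pcompose flip: poly_0_coeff_0)
  also have "\<dots> = fact m * taylor_coeff p z m"
    by (simp add: coeff_higher_pderiv taylor_coeff_def pochhammer_fact)
  finally show ?thesis by simp
qed

lemma taylor_coeff_sum: "taylor_coeff (\<Sum>i\<in>I. f i) z m = (\<Sum>i\<in>I. taylor_coeff (f i) z m)"
  by (simp add: taylor_coeff_def pcompose_sum coeff_sum)

lemma taylor_coeff_add: "taylor_coeff (p + q) z m = taylor_coeff p z m + taylor_coeff q z m"
  by (simp add: taylor_coeff_def pcompose_add)

lemma taylor_coeff_mult:
  "taylor_coeff (p * q) z m = (\<Sum>i\<le>m. taylor_coeff p z i * taylor_coeff q z (m - i))"
  by (simp add: taylor_coeff_def pcompose_mult coeff_mult)

lemma taylor_coeff_monom: "taylor_coeff (monom c i) z m = c * taylor_coeff (monom 1 i) z m"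
proof -
  have "monom c i = smult c (monom 1 i)" by (simp add: smult_monom)
  then show ?thesis unfolding taylor_coeff_def by (simp only: pcompose_smult coeff_smult)
qed

lemma taylor_coeff_monom_eq_0:
  assumes "i < m"
  shows "taylor_coeff (monom c i) z m = 0"
proof -
  have "degree (pcompose (monom c i) [:z, 1:]) \<le> i"
    by (rule order_trans[OF degree_pcompose_le]) (simp add: degree_monom_le)
  then show ?thesis using assms by (simp add: taylor_coeff_def coeff_eq_0)
qed

lemma taylor_coeff_0: "taylor_coeff p z 0 = poly p z"
  by (simp flip: taylor_coeff_higher_pderiv)

section \<open>Block structure of the matrices \<open>T_mat\<close> and \<open>M_mat\<close>\<close>

lemma sum_blocks: "(\<Sum>a<m * n. f a) = (\<Sum>i<m. \<Sum>b<n. f (i * n + b))"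
  for f :: "nat \<Rightarrow> 'a :: comm_monoid_add"
proof -
  have "(\<Sum>a<m * n. f a) = (\<Sum>i<m. sum f {i * n..<i * n + n})"
    by (simp add: sum.nat_group)
  also have "\<dots> = (\<Sum>i<m. \<Sum>b<n. f (i * n + b))"
  proof (rule sum.cong[OF refl])
    fix i
    show "sum f {i * n..<i * n + n} = (\<Sum>b<n. f (i * n + b))"
      by (rule sum.reindex_bij_witness[of _ "\<lambda>b. i * n + b" "\<lambda>c. c - i * n"]) auto
  qed
  finally show ?thesis .
qed

lemma block_index_less: "i < m \<Longrightarrow> b < n \<Longrightarrow> i * n + b < m * (n :: nat)"
proof -
  assume "i < m" "b < n"
  then have "i * n + b < Suc i * n" "Suc i * n \<le> m * n" by (simp, intro mult_le_mono1) auto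
  then show ?thesis by linarith
qed

text \<open>
  With blocks numbered from $0$ and $w_i = \gamma_1 \cdots \gamma_i$, this is $w_i / w_j$ whenever
  $j \leq i$, in a form that avoids division. Hence \<open>T_mat\<close> is the block Toeplitz matrix of
  Taylor coefficients conjugated by the block diagonal matrix of the $w_i$.
\<close>

definition scale_prod :: "(nat \<Rightarrow> real) \<Rightarrow> nat \<Rightarrow> nat \<Rightarrow> real" where
  "scale_prod \<gamma> j i = (\<Prod>l\<in>{Suc j..i}. \<gamma> l)"

lemma T_mat_index:
  assumes "i \<le> r" "j \<le> r" "a < n" "b < n"
  shows "T_mat n r \<gamma> P z $$ (i * n + a, j * n + b)
    = (if j \<le> i then complex_of_real (scale_prod \<gamma> j i) * taylor_coeff (P $$ (a, b)) z (i - j) else 0)"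
  using assms block_index_less[of i "r + 1" a n] block_index_less[of j "r + 1" b n]
  by (simp add: T_mat_def Let_def scale_prod_def taylor_coeff_higher_pderiv atLeastLessThanSuc_atLeastAtMost)

lemma T_mat_mult_vec_index:
  assumes "i \<le> r" "a < n" "x \<in> carrier_vec ((r + 1) * n)"
  shows "(T_mat n r \<gamma> P z *\<^sub>v x) $ (i * n + a)
    = (\<Sum>j\<le>i. \<Sum>b<n. complex_of_real (scale_prod \<gamma> j i) * taylor_coeff (P $$ (a, b)) z (i - j) * x $ (j * n + b))"
proof -
  have "i * n + a < (r + 1) * n" using assms block_index_less[of i "r + 1" a n] by simp
  then have "(T_mat n r \<gamma> P z *\<^sub>v x) $ (i * n + a)
    = (\<Sum>c<(r + 1) * n. T_mat n r \<gamma> P z $$ (i * n + a, c) * x $ c)"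
    using assms(3) by (simp add: scalar_prod_def atLeast0LessThan T_mat_def)
  also have "\<dots> = (\<Sum>j<r + 1. \<Sum>b<n. T_mat n r \<gamma> P z $$ (i * n + a, j * n + b) * x $ (j * n + b))"
    by (rule sum_blocks)
  also have "\<dots> = (\<Sum>j<r + 1. if j \<le> i then (\<Sum>b<n. complex_of_real (scale_prod \<gamma> j i) * taylor_coeff (P $$ (a, b)) z (i - j) * x $ (j * n + b)) else 0)"
    using assms by (intro sum.cong refl) (auto simp: T_mat_index)
  also have "\<dots> = (\<Sum>j\<in>{j \<in> {..<r + 1}. j \<le> i}. \<Sum>b<n. complex_of_real (scale_prod \<gamma> j i) * taylor_coeff (P $$ (a, b)) z (i - j) * x $ (j * n + b))"
    by (rule sum.inter_filter[symmetric]) simp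
  also have "{j \<in> {..<r + 1}. j \<le> i} = {..i}" using assms by auto
  finally show ?thesis .
qed

lemma M_mat_mult_vec_index:
  assumes "l \<le> k" "b < n" "x \<in> carrier_vec ((min r k + 1) * n)"
  shows "(M_mat n k r z *\<^sub>v x) $ (l * n + b) = (\<Sum>m\<le>min r k. taylor_coeff (monom 1 l) z m * x $ (m * n + b))"
proof -
  have lb: "l * n + b < (k + 1) * n" using assms block_index_less[of l "k + 1" b n] by simp
  then have "(M_mat n k r z *\<^sub>v x) $ (l * n + b)
    = (\<Sum>c<(min r k + 1) * n. M_mat n k r z $$ (l * n + b, c) * x $ c)"
    using assms(3) by (simp add: scalar_prod_def atLeast0LessThan M_mat_def kronecker_def H_mat_def)
  also have "\<dots> = (\<Sum>m<min r k + 1. \<Sum>b'<n. M_mat n k r z $$ (l * n + b, m * n + b') * x $ (m * n + b'))"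
    by (rule sum_blocks)
  also have "\<dots> = (\<Sum>m<min r k + 1. \<Sum>b'<n. if b' = b then taylor_coeff (monom 1 l) z m * x $ (m * n + b) else 0)"
  proof (intro sum.cong refl)
    fix m b' assume "m \<in> {..<min r k + 1}" "b' \<in> {..<n}"
    then show "M_mat n k r z $$ (l * n + b, m * n + b') * x $ (m * n + b')
      = (if b' = b then taylor_coeff (monom 1 l) z m * x $ (m * n + b) else 0)"
      using assms lb block_index_less[of m "min r k + 1" b' n]
      by (auto simp: M_mat_def kronecker_def H_mat_def taylor_coeff_higher_pderiv)
  qed
  also have "\<dots> = (\<Sum>m\<le>min r k. taylor_coeff (monom 1 l) z m * x $ (m * n + b))"
    using assms by (simp add: lessThan_Suc_atMost)
  finally show ?thesis .
qed

lemma taylor_coeff_mat_poly: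
  assumes "a < n" "b < n"
  shows "taylor_coeff (mat_poly n k D $$ (a, b)) z m = (\<Sum>l\<le>k. D l $$ (a, b) * taylor_coeff (monom 1 l) z m)"
  using assms by (simp add: mat_poly_def taylor_coeff_sum taylor_coeff_monom[of "_ $$ _"])

lemma taylor_coeff_mat_poly_eq_0:
  assumes "a < n" "b < n" "k < m"
  shows "taylor_coeff (mat_poly n k D $$ (a, b)) z m = 0"
  unfolding taylor_coeff_mat_poly[OF assms(1,2)] using assms(3)
  by (auto intro!: sum.neutral simp: taylor_coeff_monom_eq_0)

text \<open>
  The product of \<open>block_row\<close> and \<open>M_mat\<close> is the block row of the Taylor coefficients of the
  perturbation. This is where $\|M(\lambda_0; r)\|_2$ enters the final bound.
\<close>

lemma block_row_M_mat_mult_vec_index: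
  assumes "a < n" "x \<in> carrier_vec ((min r k + 1) * n)"
  shows "(block_row n k D *\<^sub>v (M_mat n k r z *\<^sub>v x)) $ a
    = (\<Sum>m\<le>min r k. \<Sum>b<n. taylor_coeff (mat_poly n k D $$ (a, b)) z m * x $ (m * n + b))"
proof -
  let ?y = "M_mat n k r z *\<^sub>v x"
  have "dim_vec ?y = (k + 1) * n" by (simp add: M_mat_def kronecker_def H_mat_def)
  then have "(block_row n k D *\<^sub>v ?y) $ a = (\<Sum>c<(k + 1) * n. block_row n k D $$ (a, c) * ?y $ c)"
    using assms(1) by (simp add: scalar_prod_def atLeast0LessThan block_row_def)
  also have "\<dots> = (\<Sum>l<k + 1. \<Sum>b<n. block_row n k D $$ (a, l * n + b) * ?y $ (l * n + b))"
    by (rule sum_blocks)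
  also have "\<dots> = (\<Sum>l<k + 1. \<Sum>b<n. \<Sum>m\<le>min r k. D l $$ (a, b) * taylor_coeff (monom 1 l) z m * x $ (m * n + b))"
  proof (intro sum.cong refl)
    fix l b assume lb: "l \<in> {..<k + 1}" "b \<in> {..<n}"
    then have "block_row n k D $$ (a, l * n + b) = D l $$ (a, b)"
      using assms block_index_less[of l "k + 1" b n] by (simp add: block_row_def)
    then show "block_row n k D $$ (a, l * n + b) * ?y $ (l * n + b)
      = (\<Sum>m\<le>min r k. D l $$ (a, b) * taylor_coeff (monom 1 l) z m * x $ (m * n + b))"
      using lb assms M_mat_mult_vec_index[of l k b n x r z] by (simp add: sum_distrib_left mult.assoc)
  qed
  also have "\<dots> = (\<Sum>l<k + 1. \<Sum>m\<le>min r k. \<Sum>b<n. D l $$ (a, b) * taylor_coeff (monom 1 l) z m * x $ (m * n + b))"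
    by (intro sum.cong refl sum.swap)
  also have "\<dots> = (\<Sum>m\<le>min r k. \<Sum>l<k + 1. \<Sum>b<n. D l $$ (a, b) * taylor_coeff (monom 1 l) z m * x $ (m * n + b))"
    by (rule sum.swap)
  also have "\<dots> = (\<Sum>m\<le>min r k. \<Sum>b<n. \<Sum>l<k + 1. D l $$ (a, b) * taylor_coeff (monom 1 l) z m * x $ (m * n + b))"
    by (intro sum.cong refl sum.swap)
  also have "\<dots> = (\<Sum>m\<le>min r k. \<Sum>b<n. taylor_coeff (mat_poly n k D $$ (a, b)) z m * x $ (m * n + b))"
    using assms by (intro sum.cong refl) (simp add: taylor_coeff_mat_poly sum_distrib_right lessThan_Suc_atMost)
  finally show ?thesis .
qed

section \<open>The norm of the perturbation block matrix\<close>

lemma coeff_norm_nonneg: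
  assumes "0 < n"
  shows "0 \<le> coeff_norm s n k D"
  using assms by (cases s) (auto intro!: spectral_norm_nonneg sum_nonneg simp: block_row_def)

text \<open>
  The spectral choice is the operator norm of the block row and the Frobenius choice dominates it, so
  the two need no separate treatment afterwards.
\<close>

lemma block_row_norm_le:
  assumes D: "\<forall>i\<le>k. D i \<in> carrier_mat n n" and x: "x \<in> carrier_vec ((k + 1) * n)"
  shows "vec_norm2 (block_row n k D *\<^sub>v x) \<le> coeff_norm s n k D * vec_norm2 x"
proof (cases s)
  case Spectral
  then show ?thesis using spectral_norm_bound[of x "block_row n k D"] x by (simp add: block_row_def)
next
  case Frobenius
  have "(frobenius_norm (block_row n k D))\<^sup>2
    = (\<Sum>a<n. \<Sum>c<(k + 1) * n. (cmod (block_row n k D $$ (a, c)))\<^sup>2)"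
    by (simp add: frobenius_norm_sq block_row_def)
  also have "\<dots> = (\<Sum>a<n. \<Sum>l<k + 1. \<Sum>b<n. (cmod (block_row n k D $$ (a, l * n + b)))\<^sup>2)"
    by (simp only: sum_blocks)
  also have "\<dots> = (\<Sum>a<n. \<Sum>l<k + 1. \<Sum>b<n. (cmod (D l $$ (a, b)))\<^sup>2)"
    using block_index_less[of _ "k + 1" _ n] by (intro sum.cong refl) (simp add: block_row_def)
  also have "\<dots> = (\<Sum>l<k + 1. \<Sum>a<n. \<Sum>b<n. (cmod (D l $$ (a, b)))\<^sup>2)"
    by (rule sum.swap)
  also have "\<dots> = (\<Sum>l\<le>k. (frobenius_norm (D l))\<^sup>2)"
    using D by (intro sum.cong) (auto simp: frobenius_norm_sq)
  finally have "(frobenius_norm (block_row n k D))\<^sup>2 = (\<Sum>l\<le>k. (frobenius_norm (D l))\<^sup>2)" .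
  then have "coeff_norm s n k D = frobenius_norm (block_row n k D)"
    using Frobenius by (metis coeff_norm.simps(2) real_sqrt_unique frobenius_norm_nonneg)
  then show ?thesis using frobenius_norm_bound[of x "block_row n k D"] x by (simp add: block_row_def)
qed

text \<open>
  $W$ bounds the column weights: in column $j$ the blocks that can be nonzero sit in the rows
  $j \leq i \leq j + k$, because $\Delta P$ has degree at most $k$. The scaling
  factors are moved from the blocks to the vector, so that every block row becomes the same row of
  Taylor coefficients.
\<close>

lemma T_mat_norm_le:
  assumes D: "\<forall>i\<le>k. D i \<in> carrier_mat n n" and n: "0 < n"
    and x: "x \<in> carrier_vec ((r + 1) * n)"
    and W: "\<And>j. j \<le> r \<Longrightarrow> (\<Sum>i\<in>{j..min r (j + k)}. (scale_prod \<gamma> j i)\<^sup>2) \<le> W"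
  shows "vec_norm2 (T_mat n r \<gamma> (mat_poly n k D) z *\<^sub>v x)
    \<le> coeff_norm s n k D * sqrt ((spectral_norm (M_mat n k r z))\<^sup>2 * W) * vec_norm2 x"
proof -
  let ?T = "T_mat n r \<gamma> (mat_poly n k D) z" and ?M = "M_mat n k r z"
  let ?K = "coeff_norm s n k D" and ?S = "spectral_norm ?M" and ?\<mu> = "min r k"
  define X where "X j = (\<Sum>b<n. (cmod (x $ (j * n + b)))\<^sup>2)" for j
  \<comment> \<open>The blocks of \<open>x\<close> in reverse order up to block \<open>i\<close>, scaled: block \<open>m\<close> meets the
    \<open>m\<close>-th Taylor coefficient.\<close>
  define y where "y i = vec ((?\<mu> + 1) * n) (\<lambda>c. if c div n \<le> i
     then complex_of_real (scale_prod \<gamma> (i - c div n) i) * x $ ((i - c div n) * n + c mod n) else 0)" for i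
  have y: "y i \<in> carrier_vec ((?\<mu> + 1) * n)" for i by (simp add: y_def)
  have y_index: "y i $ (m * n + b) = (if m \<le> i then complex_of_real (scale_prod \<gamma> (i - m) i) * x $ ((i - m) * n + b) else 0)"
    if "m \<le> ?\<mu>" "b < n" for i m b
    unfolding y_def using that block_index_less[of m "?\<mu> + 1" b n] by (subst index_vec) auto
  have M: "?M \<in> carrier_mat ((k + 1) * n) ((?\<mu> + 1) * n)"
    by (auto simp: M_mat_def kronecker_def H_mat_def)
  have S: "0 \<le> ?S" using n M by (intro spectral_norm_nonneg) simp
  have row: "(?T *\<^sub>v x) $ (i * n + a) = (block_row n k D *\<^sub>v (?M *\<^sub>v y i)) $ a"
    if i: "i \<le> r" and a: "a < n" for i a
  proof -
    let ?g = "\<lambda>m. \<Sum>b<n. complex_of_real (scale_prod \<gamma> (i - m) i) * taylor_coeff (mat_poly n k D $$ (a, b)) z m * x $ ((i - m) * n + b)"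
    have "(?T *\<^sub>v x) $ (i * n + a) = (\<Sum>j\<le>i. ?g (i - j))"
      unfolding T_mat_mult_vec_index[OF i a x] by (intro sum.cong refl) simp
    also have "\<dots> = (\<Sum>m\<le>i. ?g m)"
      by (rule sum.reindex_bij_witness[of _ "\<lambda>m. i - m" "\<lambda>j. i - j"]) auto
    also have "\<dots> = (\<Sum>m\<in>{..i} \<inter> {..?\<mu>}. ?g m)"
    proof (rule sum.mono_neutral_right)
      show "\<forall>m\<in>{..i} - {..i} \<inter> {..?\<mu>}. ?g m = 0"
        using i a by (auto intro!: sum.neutral simp: taylor_coeff_mat_poly_eq_0)
    qed auto
    also have "\<dots> = (\<Sum>m\<le>?\<mu>. \<Sum>b<n. taylor_coeff (mat_poly n k D $$ (a, b)) z m * y i $ (m * n + b))"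
    proof (rule sum.mono_neutral_cong_left)
      show "\<forall>m\<in>{..?\<mu>} - {..i} \<inter> {..?\<mu>}. (\<Sum>b<n. taylor_coeff (mat_poly n k D $$ (a, b)) z m * y i $ (m * n + b)) = 0"
        by (intro ballI sum.neutral) (auto simp: y_index)
    qed (auto simp: y_index mult_ac)
    also have "\<dots> = (block_row n k D *\<^sub>v (?M *\<^sub>v y i)) $ a"
      using block_row_M_mat_mult_vec_index[OF a y[of i], of D z] by simp
    finally show ?thesis .
  qed
  have y_norm: "(vec_norm2 (y i))\<^sup>2 = (\<Sum>j\<in>{j. j \<le> i \<and> i \<le> j + k}. (scale_prod \<gamma> j i)\<^sup>2 * X j)"
    if i: "i \<le> r" for i
  proof -
    have "(vec_norm2 (y i))\<^sup>2 = (\<Sum>m<?\<mu> + 1. \<Sum>b<n. (cmod (y i $ (m * n + b)))\<^sup>2)"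
      using y[of i] unfolding vec_norm2_sq by (simp only: carrier_vecD sum_blocks)
    also have "\<dots> = (\<Sum>m<?\<mu> + 1. if m \<le> i then (scale_prod \<gamma> (i - m) i)\<^sup>2 * X (i - m) else 0)"
      by (intro sum.cong refl)
         (auto simp: less_Suc_eq_le y_index X_def norm_mult power_mult_distrib sum_distrib_left)
    also have "\<dots> = (\<Sum>m\<in>{m \<in> {..<?\<mu> + 1}. m \<le> i}. (scale_prod \<gamma> (i - m) i)\<^sup>2 * X (i - m))"
      by (rule sum.inter_filter[symmetric]) simp
    also have "\<dots> = (\<Sum>j\<in>{j. j \<le> i \<and> i \<le> j + k}. (scale_prod \<gamma> j i)\<^sup>2 * X j)"
      using i by (intro sum.reindex_bij_witness[of _ "\<lambda>j. i - j" "\<lambda>m. i - m"]) auto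
    finally show ?thesis .
  qed
  have "(vec_norm2 (?T *\<^sub>v x))\<^sup>2 = (\<Sum>i<r + 1. \<Sum>a<n. (cmod ((?T *\<^sub>v x) $ (i * n + a)))\<^sup>2)"
  proof -
    have "dim_vec (?T *\<^sub>v x) = (r + 1) * n" by (simp add: T_mat_def)
    then show ?thesis by (simp only: vec_norm2_sq sum_blocks)
  qed
  also have "\<dots> = (\<Sum>i\<le>r. (vec_norm2 (block_row n k D *\<^sub>v (?M *\<^sub>v y i)))\<^sup>2)"
    by (intro sum.cong) (auto simp: vec_norm2_sq row block_row_def)
  also have "\<dots> \<le> (\<Sum>i\<le>r. ?K\<^sup>2 * ?S\<^sup>2 * (vec_norm2 (y i))\<^sup>2)"
  proof (rule sum_mono)
    fix i
    have "vec_norm2 (block_row n k D *\<^sub>v (?M *\<^sub>v y i)) \<le> ?K * vec_norm2 (?M *\<^sub>v y i)"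
      using block_row_norm_le[OF D] M y by (metis mult_mat_vec_carrier)
    also have "\<dots> \<le> ?K * (?S * vec_norm2 (y i))"
      using M y by (intro mult_left_mono spectral_norm_bound coeff_norm_nonneg n) auto
    finally have "(vec_norm2 (block_row n k D *\<^sub>v (?M *\<^sub>v y i)))\<^sup>2 \<le> (?K * (?S * vec_norm2 (y i)))\<^sup>2"
      by (intro power_mono) auto
    then show "(vec_norm2 (block_row n k D *\<^sub>v (?M *\<^sub>v y i)))\<^sup>2 \<le> ?K\<^sup>2 * ?S\<^sup>2 * (vec_norm2 (y i))\<^sup>2"
      by (simp add: power_mult_distrib)
  qed
  also have "\<dots> = ?K\<^sup>2 * ?S\<^sup>2 * (\<Sum>i\<le>r. \<Sum>j\<in>{j \<in> {..r}. j \<le> i \<and> i \<le> j + k}. (scale_prod \<gamma> j i)\<^sup>2 * X j)"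
    unfolding sum_distrib_left[symmetric] using y_norm
    by (auto intro!: arg_cong2[where f = "(*)"] sum.cong)
  also have "(\<Sum>i\<le>r. \<Sum>j\<in>{j \<in> {..r}. j \<le> i \<and> i \<le> j + k}. (scale_prod \<gamma> j i)\<^sup>2 * X j)
    = (\<Sum>j\<le>r. \<Sum>i\<in>{i \<in> {..r}. j \<le> i \<and> i \<le> j + k}. (scale_prod \<gamma> j i)\<^sup>2 * X j)"
    by (rule sum.swap_restrict) auto
  also have "\<dots> = (\<Sum>j\<le>r. (\<Sum>i\<in>{j..min r (j + k)}. (scale_prod \<gamma> j i)\<^sup>2) * X j)"
    by (auto simp: sum_distrib_right intro!: sum.cong)
  also have "?K\<^sup>2 * ?S\<^sup>2 * \<dots> \<le> ?K\<^sup>2 * ?S\<^sup>2 * (\<Sum>j\<le>r. W * X j)"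
    using W by (intro mult_left_mono sum_mono mult_right_mono) (auto simp: X_def sum_nonneg)
  also have "(\<Sum>j\<le>r. W * X j) = W * (vec_norm2 x)\<^sup>2"
  proof -
    have "(vec_norm2 x)\<^sup>2 = (\<Sum>j<r + 1. X j)"
      by (simp only: vec_norm2_sq X_def sum_blocks carrier_vecD[OF x])
    then show ?thesis by (simp add: sum_distrib_left lessThan_Suc_atMost)
  qed
  also have "?K\<^sup>2 * ?S\<^sup>2 * (W * (vec_norm2 x)\<^sup>2) = (?K * sqrt (?S\<^sup>2 * W) * vec_norm2 x)\<^sup>2"
  proof -
    have "0 \<le> W" by (rule order_trans[OF _ W[of 0]]) (auto intro!: sum_nonneg)
    then show ?thesis by (simp add: power_mult_distrib)
  qed
  finally show ?thesis
    by (rule power2_le_imp_le) (use coeff_norm_nonneg[OF n] S in \<open>auto intro!: mult_nonneg_nonneg order_trans[OF _ W[of 0]] sum_nonneg\<close>)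
qed

section \<open>Kernel vectors from an elementary divisor\<close>

text \<open>
  With $d$ the $i$-th diagonal entry of the Smith form $E D F$, the vector is column $i$ of the
  adjugate of $F$: then $F g = \det F \cdot e_i$ with $\det F$ a nonzero constant, which gives both
  the divisibility of $E D F g$ and, by evaluating $F g$ at $z$, that $g$ does not vanish at $z$.
\<close>

lemma smith_form_root_vector:
  assumes smith: "smith_form n Q ds" and d: "d \<in> set ds"
  shows "\<exists>g. g \<in> carrier_vec n \<and> (\<forall>a<n. d dvd (Q *\<^sub>v g) $ a) \<and> (\<exists>b<n. poly (g $ b) z \<noteq> 0)"
proof -
  obtain i where i: "i < length ds" and di: "d = ds ! i" using d by (auto simp: in_set_conv_nth)
  with smith have i_n: "i < n" by (simp add: smith_form_def)
  define S where "S = mat n n (\<lambda>(i, j). if i = j \<and> i < length ds then ds ! i else 0)"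
  from smith obtain E F c where E: "E \<in> carrier_mat n n" and F: "F \<in> carrier_mat n n"
    and c: "c \<noteq> 0" "det F = [:c:]" and Q: "Q = E * S * F"
    unfolding smith_form_def S_def by blast
  have S: "S \<in> carrier_mat n n" by (simp add: S_def)
  define g where "g = adj_mat F *\<^sub>v unit_vec n i"
  have g: "g \<in> carrier_vec n" using adj_mat(1)[OF F] by (simp add: g_def)
  have Fg: "F *\<^sub>v g = [:c:] \<cdot>\<^sub>v unit_vec n i"
  proof -
    have "F *\<^sub>v g = (F * adj_mat F) *\<^sub>v unit_vec n i"
      using F adj_mat(1)[OF F] by (simp add: g_def assoc_mult_mat_vec[of _ n n _ n])
    also have "\<dots> = [:c:] \<cdot>\<^sub>v (1\<^sub>m n *\<^sub>v unit_vec n i)"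
      unfolding adj_mat(2)[OF F] c(2) by (rule eq_vecI) (auto simp: smult_scalar_prod_distrib[of _ n])
    finally show ?thesis by simp
  qed
  have SFg: "S *\<^sub>v ([:c:] \<cdot>\<^sub>v unit_vec n i) = ([:c:] * d) \<cdot>\<^sub>v unit_vec n i"
    using i i_n S by (intro eq_vecI) (auto simp: S_def di scalar_prod_right_unit)
  have "Q *\<^sub>v g = E *\<^sub>v (S *\<^sub>v (F *\<^sub>v g))"
    using E S F g unfolding Q by (simp add: assoc_mult_mat_vec[of _ n n _ n] mult_carrier_mat[of _ n n])
  also have "\<dots> = ([:c:] * d) \<cdot>\<^sub>v (E *\<^sub>v unit_vec n i)"
    unfolding Fg SFg using E by (intro eq_vecI) (auto simp: scalar_prod_smult_distrib[of _ n])
  finally have dvd: "\<forall>a<n. d dvd (Q *\<^sub>v g) $ a" using E by (auto simp: dvd_smult)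
  have "\<exists>b<n. poly (g $ b) z \<noteq> 0"
  proof (rule ccontr)
    assume *: "\<not> ?thesis"
    have "poly ((F *\<^sub>v g) $ i) z = (\<Sum>b<n. poly (F $$ (i, b)) z * poly (g $ b) z)"
      using F g i_n by (simp add: scalar_prod_def atLeast0LessThan poly_sum)
    also have "\<dots> = 0" using * by (intro sum.neutral) auto
    finally show False unfolding Fg using i_n c by simp
  qed
  then show ?thesis using g dvd by blast
qed

lemma taylor_coeff_eq_0_if_dvd:
  assumes "[:- z, 1:] ^ m dvd p" "i < m"
  shows "taylor_coeff p z i = 0"
proof -
  obtain h where "p = [:- z, 1:] ^ m * h" using assms(1) by (elim dvdE)
  then have "pcompose p [:z, 1:] = monom 1 m * pcompose h [:z, 1:]"
    by (simp add: pcompose_mult pcompose_hom.hom_power pcompose_pCons monom_altdef)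
  then show ?thesis using assms(2) by (simp add: taylor_coeff_def coeff_monom_mult)
qed

lemma scale_prod_pos:
  assumes "\<gamma> \<in> Gam r" "i \<le> r"
  shows "0 < scale_prod \<gamma> j i"
proof -
  have "0 < \<gamma> l" if "l \<in> {Suc j..i}" for l
    using assms that by (auto simp: Gam_def PiE_def Pi_def)
  then show ?thesis by (auto simp: scale_prod_def intro!: prod_pos)
qed

lemma scale_prod_mult:
  assumes "j \<le> i"
  shows "scale_prod \<gamma> j i * scale_prod \<gamma> 0 j = scale_prod \<gamma> 0 i"
proof -
  have "{Suc 0..i} = {Suc 0..j} \<union> {Suc j..i}" using assms by auto
  then show ?thesis by (simp add: scale_prod_def prod.union_disjoint ivl_disj_int)
qed

text \<open>
  Column $m$ holds the first $r+1$ Taylor coefficients of $(\lambda - z)^m g(\lambda)$, with block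
  $l$ scaled by $\gamma_1 \cdots \gamma_l$.
\<close>

definition root_vector_mat :: "nat \<Rightarrow> nat \<Rightarrow> (nat \<Rightarrow> real) \<Rightarrow> complex poly vec \<Rightarrow> complex \<Rightarrow> complex mat" where
  "root_vector_mat n r \<gamma> g z = mat ((r + 1) * n) (r + 1) (\<lambda>(a, m). if m \<le> a div n
     then complex_of_real (scale_prod \<gamma> 0 (a div n)) * taylor_coeff (g $ (a mod n)) z (a div n - m) else 0)"

text \<open>
  The polynomial $\sum_m y_m (\lambda - z)^m$, so that \<open>root_vector_mat\<close> maps $y$ to the scaled
  Taylor coefficients of its product with $g$.
\<close>

definition poly_of_vec_at :: "complex vec \<Rightarrow> complex \<Rightarrow> complex poly" where
  "poly_of_vec_at y z = pcompose (\<Sum>m<dim_vec y. monom (y $ m) m) [:- z, 1:]"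

lemma taylor_coeff_poly_of_vec_at: "m < dim_vec y \<Longrightarrow> taylor_coeff (poly_of_vec_at y z) z m = y $ m"
  by (simp add: taylor_coeff_def poly_of_vec_at_def pcompose_assoc[symmetric] pcompose_pCons coeff_sum)

lemma root_vector_mat_mult_vec_index:
  assumes "j \<le> r" "b < n" and y: "y \<in> carrier_vec (r + 1)"
  shows "(root_vector_mat n r \<gamma> g z *\<^sub>v y) $ (j * n + b)
    = complex_of_real (scale_prod \<gamma> 0 j) * taylor_coeff (g $ b * poly_of_vec_at y z) z j"
proof -
  have "j * n + b < (r + 1) * n" using assms block_index_less[of j "r + 1" b n] by simp
  moreover have "n \<noteq> 0" using assms by auto
  ultimately have "(root_vector_mat n r \<gamma> g z *\<^sub>v y) $ (j * n + b)
    = (\<Sum>m<r + 1. (if m \<le> j then complex_of_real (scale_prod \<gamma> 0 j) * taylor_coeff (g $ b) z (j - m) else 0) * y $ m)"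
    using assms by (simp add: root_vector_mat_def scalar_prod_def atLeast0LessThan cong: if_cong)
  also have "\<dots> = (\<Sum>m\<le>j. complex_of_real (scale_prod \<gamma> 0 j) * taylor_coeff (g $ b) z (j - m) * y $ m)"
    by (rule sum.mono_neutral_cong_right) (use assms in auto)
  also have "\<dots> = complex_of_real (scale_prod \<gamma> 0 j) * (\<Sum>i\<le>j. taylor_coeff (g $ b) z i * y $ (j - i))"
    unfolding sum_distrib_left
    by (rule sum.reindex_bij_witness[of _ "\<lambda>i. j - i" "\<lambda>m. j - m"]) (auto simp: mult_ac)
  also have "(\<Sum>i\<le>j. taylor_coeff (g $ b) z i * y $ (j - i)) = taylor_coeff (g $ b * poly_of_vec_at y z) z j"
    unfolding taylor_coeff_mult using assms by (intro sum.cong refl) (simp add: taylor_coeff_poly_of_vec_at)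
  finally show ?thesis .
qed

text \<open>
  The matrix is block lower triangular with positive multiples of $g(z) \neq 0$ on the diagonal, so
  forward substitution determines $y$.
\<close>

lemma root_vector_mat_inj:
  assumes \<gamma>: "\<gamma> \<in> Gam r" and b: "b < n" "poly (g $ b) z \<noteq> 0"
    and y: "y \<in> carrier_vec (r + 1)" and 0: "root_vector_mat n r \<gamma> g z *\<^sub>v y = 0\<^sub>v ((r + 1) * n)"
  shows "y = 0\<^sub>v (r + 1)"
proof -
  have "y $ j = 0" if "j \<le> r" for j
    using that
  proof (induction j rule: less_induct)
    case (less j)
    have "complex_of_real (scale_prod \<gamma> 0 j) * taylor_coeff (g $ b * poly_of_vec_at y z) z j = 0"
      using root_vector_mat_mult_vec_index[OF less.prems b(1) y, of \<gamma> g z] 0 less.prems b(1)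
        block_index_less[of j "r + 1" b n]
      by simp
    then have "0 = (\<Sum>i\<le>j. taylor_coeff (g $ b) z i * taylor_coeff (poly_of_vec_at y z) z (j - i))"
      using scale_prod_pos[OF \<gamma> less.prems, of 0] by (simp add: taylor_coeff_mult)
    also have "\<dots> = (\<Sum>i\<le>j. if i = 0 then poly (g $ b) z * y $ j else 0)"
      using less y by (intro sum.cong refl) (auto simp: taylor_coeff_poly_of_vec_at taylor_coeff_0)
    finally show ?case using b(2) by simp
  qed
  then show ?thesis using y by (intro eq_vecI) auto
qed

text \<open>
  The scaling factors telescope to a common factor per block row, and what remains is a Taylor
  coefficient of order at most $r$ of $Q g q$, which $(\lambda - z)^{r+1}$ divides.
\<close>

lemma T_mat_root_vector_mat:
  assumes Q: "Q \<in> carrier_mat n n" and g: "g \<in> carrier_vec n"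
    and dvd: "\<And>a. a < n \<Longrightarrow> [:- z, 1:] ^ (r + 1) dvd (Q *\<^sub>v g) $ a"
    and i: "i \<le> r" and a: "a < n" and y: "y \<in> carrier_vec (r + 1)"
  shows "(T_mat n r \<gamma> Q z *\<^sub>v (root_vector_mat n r \<gamma> g z *\<^sub>v y)) $ (i * n + a) = 0"
proof -
  let ?q = "poly_of_vec_at y z" and ?x = "root_vector_mat n r \<gamma> g z *\<^sub>v y"
  have x: "?x \<in> carrier_vec ((r + 1) * n)"
    using y by (intro mult_mat_vec_carrier[of _ _ "r + 1"]) (auto simp: root_vector_mat_def)
  have "(T_mat n r \<gamma> Q z *\<^sub>v ?x) $ (i * n + a)
    = (\<Sum>j\<le>i. \<Sum>b<n. complex_of_real (scale_prod \<gamma> j i) * taylor_coeff (Q $$ (a, b)) z (i - j) * ?x $ (j * n + b))"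
    by (rule T_mat_mult_vec_index[OF i a x])
  also have "\<dots> = (\<Sum>j\<le>i. \<Sum>b<n. complex_of_real (scale_prod \<gamma> 0 i) *
      (taylor_coeff (g $ b * ?q) z j * taylor_coeff (Q $$ (a, b)) z (i - j)))"
  proof (intro sum.cong refl)
    fix j b assume "j \<in> {..i}" "b \<in> {..<n}"
    then show "complex_of_real (scale_prod \<gamma> j i) * taylor_coeff (Q $$ (a, b)) z (i - j) * ?x $ (j * n + b)
      = complex_of_real (scale_prod \<gamma> 0 i) * (taylor_coeff (g $ b * ?q) z j * taylor_coeff (Q $$ (a, b)) z (i - j))"
      using i y by (simp add: root_vector_mat_mult_vec_index flip: scale_prod_mult[of j i])
  qed
  also have "\<dots> = complex_of_real (scale_prod \<gamma> 0 i) * (\<Sum>b<n. taylor_coeff (g $ b * ?q * Q $$ (a, b)) z i)"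
    unfolding taylor_coeff_mult[of "_ * ?q"] sum_distrib_left by (rule sum.swap)
  also have "(\<Sum>b<n. taylor_coeff (g $ b * ?q * Q $$ (a, b)) z i) = taylor_coeff ((Q *\<^sub>v g) $ a * ?q) z i"
  proof -
    have "(Q *\<^sub>v g) $ a * ?q = (\<Sum>b<n. g $ b * ?q * Q $$ (a, b))"
      using Q g a by (simp add: scalar_prod_def atLeast0LessThan sum_distrib_left sum_distrib_right mult_ac)
    then show ?thesis by (simp only: taylor_coeff_sum)
  qed
  also have "\<dots> = 0"
    using dvd[OF a] i by (intro taylor_coeff_eq_0_if_dvd[of _ "r + 1"]) auto
  finally show ?thesis by simp
qed

section \<open>Column weights\<close>

text \<open>
  Column $j$ (numbered from $0$) corresponds to $p = r - j$ in $F_1$ and $F_2$, and row $i$ to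
  $t = r + 1 - i$; the summand $1$ is the diagonal block.
\<close>

lemma sum_scale_prod_sq:
  assumes j: "j \<le> r" and q: "q \<le> r - j"
  shows "(\<Sum>i\<in>{j..j + q}. (scale_prod \<gamma> j i)\<^sup>2)
    = 1 + (\<Sum>t=r - j + 1 - q..r - j. \<Prod>i=t..r - j. (\<gamma> (r + 1 - i))\<^sup>2)"
proof -
  have "(\<Sum>i\<in>{j..j + q}. (scale_prod \<gamma> j i)\<^sup>2) = (scale_prod \<gamma> j j)\<^sup>2 + (\<Sum>i\<in>{Suc j..j + q}. (scale_prod \<gamma> j i)\<^sup>2)"
    by (rule sum.atLeast_Suc_atMost) simp
  also have "(scale_prod \<gamma> j j)\<^sup>2 = 1" by (simp add: scale_prod_def)
  also have "(\<Sum>i\<in>{Suc j..j + q}. (scale_prod \<gamma> j i)\<^sup>2)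
    = (\<Sum>t=r - j + 1 - q..r - j. \<Prod>i=t..r - j. (\<gamma> (r + 1 - i))\<^sup>2)"
  proof (rule sum.reindex_bij_witness[of _ "\<lambda>t. r + 1 - t" "\<lambda>i. r + 1 - i"])
    fix i assume i: "i \<in> {Suc j..j + q}"
    have "(\<Prod>l=r + 1 - i..r - j. (\<gamma> (r + 1 - l))\<^sup>2) = (\<Prod>l\<in>{Suc j..i}. (\<gamma> l)\<^sup>2)"
      by (rule prod.reindex_bij_witness[of _ "\<lambda>l. r + 1 - l" "\<lambda>l. r + 1 - l"]) (use i j q in auto)
    then show "(\<Prod>l=r + 1 - i..r - j. (\<gamma> (r + 1 - l))\<^sup>2) = (scale_prod \<gamma> j i)\<^sup>2"
      by (simp add: scale_prod_def prod_power_distrib)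
  qed (use j q in auto)
  finally show ?thesis .
qed

text \<open>
  The last column, $j = r$, would correspond to $p = 0$, which is outside the range of the maximum.
  Its weight is $1$, which is at most the value for $p = 1$.
\<close>

lemma column_weight_le_F1:
  assumes "0 < r" "r \<le> k" "j \<le> r"
  shows "(\<Sum>i\<in>{j..min r (j + k)}. (scale_prod \<gamma> j i)\<^sup>2)
    \<le> (MAX p\<in>{1..r}. 1 + (\<Sum>t=1..p. \<Prod>i=t..p. (\<gamma> (r + 1 - i))\<^sup>2))"
    (is "_ \<le> Max (?h ` _)")
proof -
  have "{j..min r (j + k)} = {j..j + (r - j)}" using assms by auto
  then have "(\<Sum>i\<in>{j..min r (j + k)}. (scale_prod \<gamma> j i)\<^sup>2) = ?h (r - j)"
    using sum_scale_prod_sq[OF assms(3) order_refl, of \<gamma>] by simp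
  also have "\<dots> \<le> ?h (max 1 (r - j))"
    by (cases "r - j = 0") (auto simp: max_def)
  also have "\<dots> \<le> Max (?h ` {1..r})"
    using assms by (intro Max_ge) auto
  finally show ?thesis .
qed

text \<open>
  The two maxima separate the columns whose blocks reach the last block row, $r - j \leq k$, from
  those that end earlier, at row $j + k$.
\<close>

lemma column_weight_le_F2:
  assumes "0 < k" "k < r" "j \<le> r"
  shows "(\<Sum>i\<in>{j..min r (j + k)}. (scale_prod \<gamma> j i)\<^sup>2)
    \<le> max (MAX p\<in>{1..k}. 1 + (\<Sum>t=1..p. \<Prod>i=t..p. (\<gamma> (r + 1 - i))\<^sup>2))
         (MAX p\<in>{k+1..r}. 1 + (\<Sum>t=p-k+1..p. \<Prod>i=t..p. (\<gamma> (r + 1 - i))\<^sup>2))"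
    (is "_ \<le> max (Max (?h ` _)) (Max (?h' ` _))")
proof (cases "r - j \<le> k")
  case True
  then have "{j..min r (j + k)} = {j..j + (r - j)}" using assms by auto
  then have "(\<Sum>i\<in>{j..min r (j + k)}. (scale_prod \<gamma> j i)\<^sup>2) = ?h (r - j)"
    using sum_scale_prod_sq[OF assms(3) order_refl, of \<gamma>] by simp
  also have "\<dots> \<le> ?h (max 1 (r - j))"
    by (cases "r - j = 0") (auto simp: max_def)
  also have "\<dots> \<le> Max (?h ` {1..k})"
    using assms True by (intro Max_ge) auto
  finally show ?thesis by simp
next
  case False
  then have "{j..min r (j + k)} = {j..j + k}" using assms by auto
  then have "(\<Sum>i\<in>{j..min r (j + k)}. (scale_prod \<gamma> j i)\<^sup>2) = ?h' (r - j)"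
    using sum_scale_prod_sq[OF assms(3), of k \<gamma>] False by (simp add: Suc_diff_le)
  also have "\<dots> \<le> Max (?h' ` {k+1..r})"
    using assms False by (intro Max_ge imageI) auto
  finally show ?thesis by simp
qed

section \<open>The lower bound for the distance\<close>

text \<open>
  The quotient bound for a single perturbation and a single $\gamma$, kept free of division.
\<close>

lemma f_fun_le:
  assumes D: "\<forall>i\<le>k. D i \<in> carrier_mat n n"
    and n: "0 < n" and \<gamma>: "\<gamma> \<in> Gam r"
    and ed: "\<exists>j\<ge>r + 1. [:- z0, 1:] ^ j \<in> elementary_divisors n (mat_poly n k A + mat_poly n k D)"
    and W: "\<And>j. j \<le> r \<Longrightarrow> (\<Sum>i\<in>{j..min r (j + k)}. (scale_prod \<gamma> j i)\<^sup>2) \<le> W"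
  shows "f_fun n k r A z0 \<gamma> \<le> coeff_norm s n k D * sqrt ((spectral_norm (M_mat n k r z0))\<^sup>2 * W)"
proof -
  let ?P = "mat_poly n k A" and ?D = "mat_poly n k D"
  let ?N = "(r + 1) * n" and ?C = "coeff_norm s n k D * sqrt ((spectral_norm (M_mat n k r z0))\<^sup>2 * W)"
  obtain j \<mu> c ds d where j: "r + 1 \<le> j" and eq: "[:- z0, 1:] ^ j = [:- \<mu>, 1:] ^ c"
    and smith: "smith_form n (?P + ?D) ds" and d: "d \<in> set ds" "order \<mu> d = c"
    using ed unfolding elementary_divisors_def by blast
  have "[:- z0, 1:] ^ (r + 1) dvd [:- \<mu>, 1:] ^ c"
    unfolding eq[symmetric] using j by (rule le_imp_power_dvd)
  then have d_dvd: "[:- z0, 1:] ^ (r + 1) dvd d"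
    using order_1[of \<mu> d] d(2) dvd_trans by blast
  obtain g b where g: "g \<in> carrier_vec n" and gd: "\<forall>a<n. d dvd ((?P + ?D) *\<^sub>v g) $ a"
    and b: "b < n" "poly (g $ b) z0 \<noteq> 0"
    using smith_form_root_vector[OF smith d(1)] by blast
  let ?X = "root_vector_mat n r \<gamma> g z0"
  have PD: "?P + ?D \<in> carrier_mat n n" by (simp add: mat_poly_def)
  have X: "?X \<in> carrier_mat ?N (Suc r)" by (simp add: root_vector_mat_def)
  have T: "T_mat n r \<gamma> P z0 \<in> carrier_mat ?N ?N" for P by (simp add: T_mat_def)
  show ?thesis
    unfolding f_fun_def
  proof (rule singular_value_le[OF T _ X])
    show "r < ?N" using n by (cases n) auto
    show "y = 0\<^sub>v (Suc r)" if "y \<in> carrier_vec (Suc r)" "?X *\<^sub>v y = 0\<^sub>v ?N" for y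
      using root_vector_mat_inj[OF \<gamma> b, of y] that by simp
    show "0 \<le> ?C"
      using coeff_norm_nonneg[OF n, of s k D] W[of 0] by (auto intro!: mult_nonneg_nonneg order_trans[OF _ W[of 0]] sum_nonneg)
    fix y :: "complex vec" assume y: "y \<in> carrier_vec (Suc r)"
    have x: "?X *\<^sub>v y \<in> carrier_vec ?N" by (rule mult_mat_vec_carrier[OF X y])
    have "T_mat n r \<gamma> ?P z0 *\<^sub>v (?X *\<^sub>v y) = - (T_mat n r \<gamma> ?D z0 *\<^sub>v (?X *\<^sub>v y))"
    proof (rule eq_vecI)
      fix e assume "e < dim_vec (- (T_mat n r \<gamma> ?D z0 *\<^sub>v (?X *\<^sub>v y)))"
      then have e: "e < ?N" by (simp add: T_mat_def)
      define i a where "i = e div n" and "a = e mod n"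
      have ia: "e = i * n + a" "i \<le> r" "a < n"
        using e n less_mult_imp_div_less[of e "r + 1" n] by (simp_all add: i_def a_def)
      have "(T_mat n r \<gamma> ?P z0 *\<^sub>v (?X *\<^sub>v y)) $ e + (T_mat n r \<gamma> ?D z0 *\<^sub>v (?X *\<^sub>v y)) $ e
        = (T_mat n r \<gamma> (?P + ?D) z0 *\<^sub>v (?X *\<^sub>v y)) $ e"
        unfolding ia(1) T_mat_mult_vec_index[OF ia(2,3) x] sum.distrib[symmetric]
        using ia(3) by (intro sum.cong refl) (simp add: mat_poly_def taylor_coeff_add algebra_simps)
      also have "\<dots> = 0"
        unfolding ia(1) using y gd d_dvd dvd_trans by (intro T_mat_root_vector_mat[OF PD g _ ia(2,3)]) auto
      finally show "(T_mat n r \<gamma> ?P z0 *\<^sub>v (?X *\<^sub>v y)) $ e = (- (T_mat n r \<gamma> ?D z0 *\<^sub>v (?X *\<^sub>v y))) $ e"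
        using e T[of ?D] by (simp add: eq_neg_iff_add_eq_0)
    qed (simp add: T_mat_def)
    then show "vec_norm2 (T_mat n r \<gamma> ?P z0 *\<^sub>v (?X *\<^sub>v y)) \<le> ?C * vec_norm2 (?X *\<^sub>v y)"
      using T_mat_norm_le[OF D n x W, where z = z0 and s = s] by (simp add: vec_norm2_uminus)
  qed
qed

theorem theorem7p1:
  fixes n k r :: nat and A :: "nat \<Rightarrow> complex mat" and z0 :: complex and s :: norm_kind
  assumes "\<forall>i\<le>k. A i \<in> carrier_mat n n"
    and "A k \<noteq> 0\<^sub>m n n"
    and "0 < r" and "r < k * n"
  shows "ed_distance s n k A z0 (r + 1) \<ge>
    (if r \<le> k then (SUP \<gamma>\<in>Gam r. ereal (f_fun n k r A z0 \<gamma> / sqrt (F1 n k r z0 \<gamma>)))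
     else (SUP \<gamma>\<in>Gam r. ereal (f_fun n k r A z0 \<gamma> / sqrt (F2 n k r z0 \<gamma>))))"
proof -
  have n: "0 < n" and k: "0 < k" using assms(4) by (auto intro!: gr0I)
  \<comment> \<open>In the case \<open>F = 0\<close> the quotient is \<open>0\<close>, since division by zero yields zero.\<close>
  have quotient_le: "f / sqrt F \<le> K" if "f \<le> K * sqrt F" "0 \<le> K" "0 \<le> F" for f F K :: real
    using that by (cases "F = 0") (auto simp: divide_le_eq)
  have *: "(SUP \<gamma>\<in>Gam r. ereal (f_fun n k r A z0 \<gamma> / sqrt ((spectral_norm (M_mat n k r z0))\<^sup>2 * W \<gamma>)))
      \<le> ed_distance s n k A z0 (r + 1)"
    if W: "\<And>\<gamma> j. j \<le> r \<Longrightarrow> (\<Sum>i\<in>{j..min r (j + k)}. (scale_prod \<gamma> j i)\<^sup>2) \<le> W \<gamma>" for W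
  proof (unfold ed_distance_def, intro SUP_least INF_greatest)
    fix \<gamma> D
    assume "\<gamma> \<in> Gam r" and "D \<in> {D. (\<forall>i\<le>k. D i \<in> carrier_mat n n) \<and>
      (\<exists>j\<ge>r + 1. [:- z0, 1:] ^ j \<in> elementary_divisors n (mat_poly n k A + mat_poly n k D))}"
    then have "f_fun n k r A z0 \<gamma> \<le> coeff_norm s n k D * sqrt ((spectral_norm (M_mat n k r z0))\<^sup>2 * W \<gamma>)"
      using f_fun_le[OF _ n _ _ W] by blast
    moreover have "0 \<le> W \<gamma>" by (rule order_trans[OF _ W[of 0]]) (auto intro!: sum_nonneg)
    ultimately show "ereal (f_fun n k r A z0 \<gamma> / sqrt ((spectral_norm (M_mat n k r z0))\<^sup>2 * W \<gamma>)) \<le> ereal (coeff_norm s n k D)"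
      using quotient_le coeff_norm_nonneg[OF n] by simp
  qed
  show ?thesis
    using *[OF column_weight_le_F1[OF assms(3)]] *[OF column_weight_le_F2[OF k]]
    by (auto simp: F1_def F2_def)
qed

end
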